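(* The function $x\mapsto \dfrac{\pi(x)}{x/\log x}$, defined for real $x\in(1,\infty)$, converges to $1$ as $x\to\infty$; that is, $$\lim_{x\to\infty}\frac{\pi(x)}{x/\log x}=1 .$$
   Context: For real $x$, $\pi(x)$ denotes the number of primes $p$ with $p\le x$. $\log$ is the natural logarithm. *)

theory Defs
  imports Complex_Main "HOL-Computational_Algebra.Primes"
begin

definition prime_count :: "real \<Rightarrow> nat" where
  "prime_count x = card {p :: nat. prime p \<and> real p \<le> x}"

text \<open>The set counted above is finite, so the cardinality is never the default value \<open>0\<close>
  of an infinite set.\<close>

lemma finite_primes_le_real: "finite {p :: nat. prime p \<and> real p \<le> x}"
proof (rule finite_subset)
  show "{p :: nat. prime p \<and> real p \<le> x} \<subseteq> {..nat \<lfloor>x\<rfloor>}"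
    by (auto simp: le_nat_floor)
qed simp

end

theory Submission
  imports Defs "HOL-Complex_Analysis.Complex_Analysis" "HOL-Number_Theory.Prime_Powers" "HOL-Real_Asymp.Real_Asymp"
begin

text \<open>This is Newman's proof. By Chebyshev's bound \<open>psi x = O(x)\<close>, the integral of \<open>(psi x - x) / x\<^sup>2\<close> times
  \<open>x powr (- z)\<close> converges for \<open>Re z > 0\<close>, where it is expressed through the logarithmic derivative of
  \<open>(s - 1) * zeta s\<close> at \<open>s = z + 1\<close>. Since zeta has no zeros with \<open>Re s \<ge> 1\<close> (Mertens' 3-4-1 inequality),
  it continues across \<open>Re z = 0\<close>, and Newman's contour argument gives convergence at \<open>z = 0\<close>. As \<open>psi\<close> is
  monotone, this forces \<open>psi x / x \<longlonglongrightarrow> 1\<close>. The integrals are cut at the integers, so that every partial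
  integral is a finite sum of explicit entire functions.\<close>

section \<open>Chebyshev's function psi\<close>

text \<open>The difficulty is to reach the boundary point without any growth bound for zeta on
  vertical lines: the region of continuation may narrow towards the imaginary axis as |Im z| grows.
  Newman's contours therefore have a fixed radius R. The partial sums are entire, so they may be
  integrated over the whole left semicircle, whereas the limit function is used only up to the
  imaginary axis. N tends to infinity first, with an error O(1 / R) from each semicircle, and R
  grows afterwards. Chebyshev's bound makes the integrand O(x powr (- Re z - 1)), and its constant
  becomes the constant of these errors. The function psi is preferred to a plain count of primes
  because its jumps are the coefficients of - zeta' / zeta. Monotonicity closes the argument: if psi
  N exceeded N by a fixed proportion, then psi x would exceed x on a whole interval [N, r N], which
  would add a fixed positive amount to a convergent integral for arbitrarily large N; a deficit is
  treated in the same way.\<close>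

definition psi :: "nat \<Rightarrow> real" where
  "psi n = (\<Sum>d\<in>{1..n}. mangoldt d)"

lemma psi_0 [simp]: "psi 0 = 0"
  by (simp add: psi_def)

lemma psi_Suc: "psi (Suc n) = psi n + mangoldt (Suc n)"
  by (simp add: psi_def)

lemma psi_mono: "m \<le> n \<Longrightarrow> psi m \<le> psi n"
  unfolding psi_def by (intro sum_mono2) (auto simp: mangoldt_nonneg)

lemma psi_nonneg: "psi n \<ge> 0"
  unfolding psi_def by (intro sum_nonneg) (auto simp: mangoldt_nonneg)

section \<open>Chebyshev's upper bound for psi\<close>

text \<open>Write each \<open>ln m\<close> as the sum of \<open>mangoldt d\<close> over
  \<open>d dvd m\<close> and count the multiples of \<open>d\<close> up to \<open>n\<close>. The
  range may be longer than \<open>n\<close>, since the extra quotients are 0; this lets the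
  factorials of \<open>n\<close> and \<open>2 * n\<close> be compared term by term.\<close>

lemma ln_fact_conv_mangoldt:
  assumes "n \<le> N"
  shows "ln (fact n :: real) = (\<Sum>d\<in>{1..N}. mangoldt d * real (n div d))"
proof -
  have card: "card {m\<in>{1..n}. d dvd m} = n div d" if "d \<ge> 1" for d
  proof -
    have "{m\<in>{1..n}. d dvd m} = (\<lambda>k. d * k) ` {1..n div d}"
      using that by (auto elim!: dvdE simp: div_le_mono less_eq_div_iff_mult_less_eq mult.commute image_iff)
    thus ?thesis using that by (simp add: card_image inj_on_def)
  qed
  have "ln (fact n :: real) = (\<Sum>m\<in>{1..n}. ln (real m))"
    unfolding fact_prod by (subst of_nat_prod, subst ln_prod) auto
  also have "\<dots> = (\<Sum>m\<in>{1..n}. \<Sum>d | d dvd m. mangoldt d)"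
    by (intro sum.cong refl, subst mangoldt_sum) auto
  also have "\<dots> = (\<Sum>m\<in>{1..n}. \<Sum>d | d \<in> {1..N} \<and> d dvd m. mangoldt d)"
    using assms by (intro sum.cong refl) (auto dest: dvd_imp_le intro: Suc_leI dvd_pos_nat)
  also have "\<dots> = (\<Sum>d\<in>{1..N}. \<Sum>m | m \<in> {1..n} \<and> d dvd m. mangoldt d)"
    by (rule sum.swap_restrict) auto
  also have "\<dots> = (\<Sum>d\<in>{1..N}. mangoldt d * real (n div d))"
    by (intro sum.cong refl) (simp add: card[simplified])
  finally show ?thesis .
qed

text \<open>The weight \<open>2n div d - 2 * (n div d)\<close> is never negative and is at least 1
  for n < d \<le> 2n, so the increment of \<open>psi\<close> is at most the weighted sum. That sum
  is the logarithm of the central binomial coefficient, which is at most 4^n.\<close>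

lemma psi_double: "psi (2 * n) \<le> psi n + 2 * real n * ln 2"
proof -
  let ?N = "2 * n"
  have "psi ?N - psi n = (\<Sum>d\<in>{1..?N} - {1..n}. mangoldt d)"
    unfolding psi_def by (subst sum_diff) auto
  also have "\<dots> \<le> (\<Sum>d\<in>{1..?N} - {1..n}. mangoldt d * (real (?N div d) - 2 * real (n div d)))"
  proof (intro sum_mono)
    fix d assume d: "d \<in> {1..?N} - {1..n}"
    hence "?N div d \<ge> 1" by (auto simp: Suc_le_eq div_greater_zero_iff)
    moreover have "n div d = 0" using d by auto
    ultimately show "mangoldt d \<le> mangoldt d * (real (?N div d) - 2 * real (n div d))"
      using mult_left_mono[of 1 "real (?N div d) - 2 * real (n div d)" "mangoldt d"]
      by (simp add: mangoldt_nonneg)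
  qed
  also have "\<dots> \<le> (\<Sum>d\<in>{1..?N}. mangoldt d * (real (?N div d) - 2 * real (n div d)))"
  proof (intro sum_mono2)
    fix d
    have "2 * (n div d) \<le> ?N div d"
      by (metis div_mult_swap div_times_less_eq_dividend less_eq_div_iff_mult_less_eq bot_nat_0.not_eq_extremum div_by_0 mult.assoc mult.commute mult_le_mono2 mult_zero_right order_refl)
    hence "2 * real (n div d) \<le> real (?N div d)"
      by (metis of_nat_le_iff of_nat_mult of_nat_numeral)
    thus "0 \<le> mangoldt d * (real (?N div d) - 2 * real (n div d))"
      by (intro mult_nonneg_nonneg) (auto simp: mangoldt_nonneg)
  qed auto
  also have "\<dots> = ln (fact ?N :: real) - 2 * ln (fact n :: real)"
    by (subst ln_fact_conv_mangoldt[of ?N ?N], simp, subst ln_fact_conv_mangoldt[of n ?N], simp)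
       (simp add: sum_subtractf sum_distrib_left algebra_simps)
  also have "\<dots> = ln (real (?N choose n))"
    by (subst binomial_fact) (auto simp: ln_div ln_mult)
  also have "\<dots> \<le> ln (2 ^ ?N)"
  proof (subst ln_le_cancel_iff)
    have "?N choose n \<le> 2 ^ ?N" by (rule binomial_le_pow2)
    thus "real (?N choose n) \<le> 2 ^ ?N" by (metis of_nat_le_iff of_nat_numeral of_nat_power)
  qed auto
  also have "\<dots> = 2 * real n * ln 2" by (subst ln_realpow) auto
  finally show ?thesis by simp
qed

text \<open>Halving with rounding up: for m about n/2 the induction hypothesis and ln 2 \<le> 3/4
  give psi (2m) \<le> 3m + 3m/2, well below 6m, and the slack pays for the rounding.\<close>

lemma psi_le: "psi n \<le> 3 * real n"
proof (induction n rule: less_induct)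
  case (less n)
  have ln2: "ln (2::real) \<le> 3/4" using ln2_le_25_over_36 by simp
  consider "n = 0" | "n = 1" | "n \<ge> 2" by linarith
  thus ?case
  proof cases
    case 2 thus ?thesis by (simp add: psi_def)
  next
    case 3
    define m where "m = (n + 1) div 2"
    have m: "m < n" "n \<le> 2 * m" "2 * m \<le> n + 1" "m \<ge> 1" using 3 by (auto simp: m_def)
    show ?thesis
    proof (cases "n = 2 * m")
      case True
      have "psi (2 * m) \<le> 3 * real (2 * m)"
        using psi_double[of m] less(1)[of m] m mult_left_mono[OF ln2, of "2 * real m"] by linarith
      thus ?thesis using True by simp
    next
      case False
      hence nm: "n = 2 * m - 1" using m by simp
      hence m2: "m \<ge> 2" using 3 by auto
      have "psi n \<le> psi (2 * m)" using m by (intro psi_mono) auto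
      also have "\<dots> \<le> 3 * real m + 2 * real m * (3/4)"
        using psi_double[of m] less(1)[of m] m mult_left_mono[OF ln2, of "2 * real m"] by linarith
      \<comment> \<open>This is 4.5 m \<le> 3 (2m - 1), true from m = 2 on; an odd n \<ge> 3
        guarantees that.\<close>
      also have "\<dots> \<le> 3 * real n" using nm m2 by (simp add: of_nat_diff)
      finally show ?thesis .
    qed
  qed auto
qed

section \<open>Comparison of psi with the number of primes\<close>

text \<open>Group the prime powers up to \<open>x\<close> by their prime. A prime \<open>p\<close>
  has at most \<open>ln x / ln p\<close> powers in the range, each of weight \<open>ln p\<close>, so
  it contributes at most \<open>ln x\<close>.\<close>

lemma psi_le_prime_count:
  assumes "x \<ge> 1"
  shows "psi (nat \<lfloor>x\<rfloor>) \<le> real (prime_count x) * ln x"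
proof -
  define n where "n = nat \<lfloor>x\<rfloor>"
  have n: "n \<ge> 1" "real n \<le> x" using assms by (auto simp: n_def le_nat_floor)
  let ?P = "{p. prime p \<and> p \<le> n}"
  have PP: "{p. prime p \<and> real p \<le> x} = ?P"
    using assms by (auto simp: n_def le_nat_floor le_nat_iff le_floor_iff)
  have "psi n = (\<Sum>d\<in>{d\<in>{1..n}. primepow d}. ln (real (aprimedivisor d)))"
    unfolding psi_def by (intro sum.mono_neutral_cong_right) (auto simp: mangoldt_def)
  also have "\<dots> = (\<Sum>p\<in>?P. \<Sum>d\<in>{d\<in>{d\<in>{1..n}. primepow d}. aprimedivisor d = p}. ln (real (aprimedivisor d)))"
  proof (rule sum.group[symmetric])
    show "aprimedivisor ` {d \<in> {1..n}. primepow d} \<subseteq> ?P"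
    proof safe
      fix d assume d: "d \<in> {1..n}" "primepow d"
      show "prime (aprimedivisor d)"
        using d primepow_gt_Suc_0[of d] by (intro prime_aprimedivisor') auto
      show "aprimedivisor d \<le> n" using d primepow_gt_Suc_0[of d] aprimedivisor_le_nat[of d] by auto
    qed
  qed auto
  also have "\<dots> \<le> (\<Sum>p\<in>?P. ln x)"
  proof (intro sum_mono)
    fix p assume "p \<in> ?P"
    hence p: "prime p" "p \<le> n" by auto
    define K where "K = {k. k \<ge> 1 \<and> p ^ k \<le> n}"
    have p1: "p > 1" using p prime_gt_1_nat by blast
    have Kb: "K \<subseteq> {1..nat \<lfloor>ln x / ln p\<rfloor>}"
    proof
      fix k assume k: "k \<in> K"
      hence "real (p ^ k) \<le> x" using n(2) by (auto simp: K_def intro: order.trans[OF _ n(2)])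
      hence "ln (real (p ^ k)) \<le> ln x" using p1 by (subst ln_le_cancel_iff) (use assms in auto)
      hence "real k * ln p \<le> ln x" using p1 by (simp add: ln_realpow)
      hence "real k \<le> ln x / ln p" using p1 by (simp add: field_simps)
      thus "k \<in> {1..nat \<lfloor>ln x / ln p\<rfloor>}" using k by (auto simp: K_def le_nat_floor)
    qed
    have "{d\<in>{d\<in>{1..n}. primepow d}. aprimedivisor d = p} \<subseteq> (\<lambda>k. p ^ k) ` K"
    proof safe
      fix d assume d: "d \<in> {1..n}" "primepow d" "p = aprimedivisor d"
      then obtain q k where qk: "prime q" "k > 0" "d = q ^ k"
        unfolding primepow_def by blast
      hence "p = q" using d aprimedivisor_prime_power[of q k] by simp
      thus "d \<in> (\<lambda>k. aprimedivisor d ^ k) ` K" using qk d by (auto simp: K_def)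
    qed
    hence "card {d\<in>{d\<in>{1..n}. primepow d}. aprimedivisor d = p} \<le> card K"
      (is "card ?S \<le> _") using Kb by (metis (no_types, lifting) card_image_le card_mono finite_atLeastAtMost finite_imageI finite_subset le_trans)
    also have "card K \<le> nat \<lfloor>ln x / ln p\<rfloor>" using card_mono[OF _ Kb] by simp
    finally have cc: "card ?S \<le> nat \<lfloor>ln x / ln p\<rfloor>" .
    have "ln x / ln p \<ge> 0" using assms p1 by (intro divide_nonneg_nonneg) auto
    hence "real (card ?S) \<le> ln x / ln p"
      using of_nat_mono[OF cc, where ?'a = real] of_nat_floor[of "ln x / ln p"] by linarith
    hence "real (card ?S) * ln p \<le> ln x"
      using p1 by (simp add: pos_le_divide_eq)
    thus "(\<Sum>d\<in>{d\<in>{d\<in>{1..n}. primepow d}. aprimedivisor d = p}. ln (real (aprimedivisor d))) \<le> ln x"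
      by simp
  qed
  also have "\<dots> = real (prime_count x) * ln x" unfolding prime_count_def PP by simp
  finally show ?thesis unfolding n_def .
qed

text \<open>Primes up to \<open>y\<close> are counted trivially; each prime beyond \<open>y\<close>
  adds more than \<open>ln y\<close> to \<open>psi\<close>.\<close>

lemma prime_count_le_psi:
  assumes "1 < y" "y \<le> x"
  shows "real (prime_count x) \<le> y + psi (nat \<lfloor>x\<rfloor>) / ln y"
proof -
  define n where "n = nat \<lfloor>x\<rfloor>"
  let ?P = "{p :: nat. prime p \<and> real p \<le> x}"
  let ?A = "{p \<in> ?P. real p \<le> y}" and ?B = "{p \<in> ?P. real p > y}"
  have fin: "finite ?P" by (rule finite_primes_le_real)
  have "card ?P = card (?A \<union> ?B)" by (intro arg_cong[of _ _ card]) auto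
  also have "\<dots> = card ?A + card ?B"
    by (rule card_Un_disjoint) (auto intro: finite_subset[OF _ fin])
  finally have 1: "real (prime_count x) = real (card ?A) + real (card ?B)" unfolding prime_count_def by simp
  have "?A \<subseteq> {1..nat \<lfloor>y\<rfloor>}"
    using prime_gt_0_nat by (auto simp: le_nat_floor Suc_le_eq)
  hence "card ?A \<le> nat \<lfloor>y\<rfloor>" using card_mono[of "{1..nat \<lfloor>y\<rfloor>}" ?A] by simp
  hence 2: "real (card ?A) \<le> y" using assms by linarith
  have "real (card ?B) * ln y = (\<Sum>p\<in>?B. ln y)" by simp
  also have "\<dots> \<le> (\<Sum>p\<in>?B. mangoldt p)"
    using assms by (intro sum_mono) auto
  also have "\<dots> \<le> psi n" unfolding psi_def
  proof (intro sum_mono2)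
    show "?B \<subseteq> {1..n}" using prime_gt_0_nat by (auto simp: n_def le_nat_floor Suc_le_eq)
  qed (auto simp: mangoldt_nonneg)
  finally have "real (card ?B) \<le> psi n / ln y" using assms by (simp add: field_simps)
  with 1 2 show ?thesis by (simp add: n_def)
qed

lemma prime_number_theorem_from_psi:
  assumes "(\<lambda>n. psi n / real n) \<longlonglongrightarrow> 1"
  shows "((\<lambda>x :: real. real (prime_count x) / (x / ln x)) \<longlongrightarrow> 1) at_top"
proof -
  have fl: "filterlim (\<lambda>x::real. nat \<lfloor>x\<rfloor>) sequentially at_top"
    by (intro filterlim_compose[OF filterlim_nat_sequentially] filterlim_floor_sequentially)
  have A: "((\<lambda>x. psi (nat \<lfloor>x\<rfloor>) / real (nat \<lfloor>x\<rfloor>) * (real (nat \<lfloor>x\<rfloor>) / x)) \<longlongrightarrow> 1 * 1) at_top"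
  proof (rule tendsto_mult)
    show "((\<lambda>x::real. psi (nat \<lfloor>x\<rfloor>) / real (nat \<lfloor>x\<rfloor>)) \<longlongrightarrow> 1) at_top"
      by (rule filterlim_compose[OF assms fl])
    show "((\<lambda>x::real. real (nat \<lfloor>x\<rfloor>) / x) \<longlongrightarrow> 1) at_top" by real_asymp
  qed
  have B: "\<forall>\<^sub>F x::real in at_top. psi (nat \<lfloor>x\<rfloor>) / real (nat \<lfloor>x\<rfloor>) * (real (nat \<lfloor>x\<rfloor>) / x) = psi (nat \<lfloor>x\<rfloor>) / x"
    using eventually_ge_at_top[of 1] by eventually_elim auto
  have lim: "((\<lambda>x. psi (nat \<lfloor>x\<rfloor>) / x) \<longlongrightarrow> 1) at_top"
    using Lim_transform_eventually[OF A B] by simp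
  \<comment> \<open>The cut must be o(x / ln x), so that the trivially counted primes are
    negligible, and yet satisfy ln y ~ ln x.\<close>
  let ?y = "\<lambda>x::real. x / (ln x)^2"
  have "((\<lambda>x. ?y x * ln x / x + psi (nat \<lfloor>x\<rfloor>) / x * (ln x / ln (?y x))) \<longlongrightarrow> 0 + 1 * 1) at_top"
  proof (intro tendsto_add tendsto_mult lim)
    show "((\<lambda>x. ?y x * ln x / x) \<longlongrightarrow> 0) at_top" by real_asymp
    show "((\<lambda>x. ln x / ln (?y x)) \<longlongrightarrow> 1) at_top" by real_asymp
  qed
  hence upper: "((\<lambda>x. ?y x * ln x / x + psi (nat \<lfloor>x\<rfloor>) / x * (ln x / ln (?y x))) \<longlongrightarrow> 1) at_top" by simp
  show ?thesis
  proof (rule tendsto_sandwich[OF _ _ lim upper])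
    show "\<forall>\<^sub>F x in at_top. psi (nat \<lfloor>x\<rfloor>) / x \<le> real (prime_count x) / (x / ln x)"
      using eventually_gt_at_top[of 1]
    proof eventually_elim
      case (elim x)
      thus ?case using psi_le_prime_count[of x] by (simp add: field_simps)
    qed
    have "\<forall>\<^sub>F x::real in at_top. 1 < ?y x" by real_asymp
    moreover have "\<forall>\<^sub>F x::real in at_top. ?y x \<le> x" by real_asymp
    ultimately show "\<forall>\<^sub>F x in at_top. real (prime_count x) / (x / ln x)
        \<le> ?y x * ln x / x + psi (nat \<lfloor>x\<rfloor>) / x * (ln x / ln (?y x))"
      using eventually_gt_at_top[of 1]
    proof eventually_elim
      case (elim x)
      have "real (prime_count x) / (x / ln x) = real (prime_count x) * (ln x / x)" by simp
      also have "\<dots> \<le> (?y x + psi (nat \<lfloor>x\<rfloor>) / ln (?y x)) * (ln x / x)"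
        using elim prime_count_le_psi[of "?y x" x] by (intro mult_right_mono) auto
      also have "\<dots> = ?y x * ln x / x + psi (nat \<lfloor>x\<rfloor>) / x * (ln x / ln (?y x))"
        by (simp add: add_divide_distrib distrib_right)
      finally show ?case .
    qed
  qed
qed

section \<open>From convergence of the integral to the asymptotics of psi\<close>

text \<open>Each summand is the integral of (psi x - x) / x^2 over [n, n + 1], where psi is
  constant. By convergence the blocks from N to M tend to 0, while on a block with M / N near r
  monotonicity replaces psi by an end value. This bounds the upper limit of psi N / N by r ln r / (r
  - 1) and the lower limit by ln r / (r - 1), and both tend to 1 as r decreases to 1.\<close>

lemma psi_asymptotics_from_convergence:
  assumes "convergent (\<lambda>N. \<Sum>n\<in>{1..<N}. psi n / (real n * (real n + 1)) - ln ((real n + 1) / real n))"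
  shows "(\<lambda>n. psi n / real n) \<longlonglongrightarrow> 1"
proof -
  define s where "s = (\<lambda>N. \<Sum>n\<in>{1..<N}. psi n / (real n * (real n + 1)) - ln ((real n + 1) / real n))"
  obtain l where l: "s \<longlonglongrightarrow> l" using assms unfolding s_def convergent_def by blast
  have diff: "s M - s N = (\<Sum>n\<in>{N..<M}. psi n / (real n * (real n + 1))) - (ln M - ln N)"
    if "1 \<le> N" "N \<le> M" for N M
  proof -
    have "s M = s N + (\<Sum>n\<in>{N..<M}. psi n / (real n * (real n + 1)) - ln ((real n + 1) / real n))"
      unfolding s_def using that by (subst sum.atLeastLessThan_concat) auto
    moreover have "(\<Sum>n\<in>{N..<M}. ln ((real n + 1) / real n)) = (\<Sum>n\<in>{N..<M}. ln (real (Suc n)) - ln (real n))"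
      using that by (intro sum.cong refl) (auto simp: ln_div add.commute)
    moreover have "\<dots> = ln M - ln N" using that by (intro sum_Suc_diff') auto
    ultimately show ?thesis by (simp add: sum_subtractf)
  qed
  have tele: "(\<Sum>n\<in>{N..<M}. c / (real n * (real n + 1))) = c * (1 / real N - 1 / real M)"
    if "1 \<le> N" "N \<le> M" for N M and c :: real
  proof -
    have "(\<Sum>n\<in>{N..<M}. c / (real n * (real n + 1))) = (\<Sum>n\<in>{N..<M}. - c / real (Suc n) - - c / real n)"
      using that by (intro sum.cong refl) (auto simp: field_simps)
    also have "\<dots> = - c / real M - - c / real N" using that by (intro sum_Suc_diff') auto
    finally show ?thesis by (simp add: field_simps)
  qed
  have lo: "psi N * (1 / real N - 1 / real M) \<le> s M - s N + ln (real M / real N)"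
    if "1 \<le> N" "N \<le> M" for N M
  proof -
    have "psi N * (1 / real N - 1 / real M) \<le> (\<Sum>n\<in>{N..<M}. psi n / (real n * (real n + 1)))"
      unfolding tele[OF that, symmetric]
      by (intro sum_mono divide_right_mono) (auto intro: psi_mono)
    thus ?thesis using diff[OF that] that by (simp add: ln_div)
  qed
  have hi: "s M - s N + ln (real M / real N) \<le> psi M * (1 / real N - 1 / real M)"
    if "1 \<le> N" "N \<le> M" for N M
  proof -
    have "(\<Sum>n\<in>{N..<M}. psi n / (real n * (real n + 1))) \<le> psi M * (1 / real N - 1 / real M)"
      unfolding tele[OF that, symmetric]
      by (intro sum_mono divide_right_mono) (auto intro: psi_mono)
    thus ?thesis using diff[OF that] that by (simp add: ln_div)
  qed
  show ?thesis
  proof (rule order_tendstoI)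
    fix a :: real assume a: "a > 1"
    \<comment> \<open>The quotient is ln r / (1 - 1/r), the limit of the bound that
      \<open>lo\<close> yields on blocks of ratio r.\<close>
    have "((\<lambda>r::real. r * ln r / (r - 1)) \<longlongrightarrow> 1) (at_right 1)" by real_asymp
    hence "\<forall>\<^sub>F r in at_right 1. r * ln r / (r - 1) < a" using a by (rule order_tendstoD)
    moreover have "\<forall>\<^sub>F r::real in at_right 1. r > 1" by (simp add: eventually_at_right_less)
    ultimately have "\<forall>\<^sub>F r::real in at_right 1. r * ln r / (r - 1) < a \<and> r > 1" by eventually_elim auto
    then obtain r :: real where r: "r > 1" "r * ln r / (r - 1) < a"
      using eventually_happens by force
    define M where "M = (\<lambda>N::nat. nat \<lceil>r * real N\<rceil>)"
    have Mlim: "(\<lambda>N. real (M N) / real N) \<longlonglongrightarrow> r"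
      unfolding M_def using r by real_asymp
    have Mtop: "filterlim M at_top sequentially"
      unfolding M_def using r by real_asymp
    have "(\<lambda>N. (s (M N) - s N + ln (real (M N) / real N)) / (1 - 1 / (real (M N) / real N))) \<longlonglongrightarrow> (l - l + ln r) / (1 - 1 / r)"
      using r by (intro tendsto_intros Mlim l filterlim_compose[OF l Mtop]) auto
    also have "(l - l + ln r) / (1 - 1 / r) = r * ln r / (r - 1)" using r by (simp add: field_simps)
    finally have "\<forall>\<^sub>F N in sequentially. (s (M N) - s N + ln (real (M N) / real N)) / (1 - 1 / (real (M N) / real N)) < a"
      using r(2) by (rule order_tendstoD)
    moreover have "\<forall>\<^sub>F N in sequentially. real (M N) / real N > 1"
      using Mlim r(1) by (rule order_tendstoD)
    ultimately show "\<forall>\<^sub>F N in sequentially. psi N / real N < a"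
      using eventually_ge_at_top[of 1]
    proof eventually_elim
      case (elim N)
      have MN: "N \<le> M N" "real (M N) > real N" using elim by (auto simp: field_simps)
      have "psi N / real N * (1 - 1 / (real (M N) / real N)) = psi N * (1 / real N - 1 / real (M N))"
        using elim by (simp add: field_simps)
      also have "\<dots> \<le> s (M N) - s N + ln (real (M N) / real N)" using lo MN elim by auto
      finally have "psi N / real N \<le> (s (M N) - s N + ln (real (M N) / real N)) / (1 - 1 / (real (M N) / real N))"
        using elim MN by (subst pos_le_divide_eq) (auto simp: field_simps)
      with elim show ?case by linarith
    qed
  next
    fix a :: real assume a: "a < 1"
    have "((\<lambda>r::real. ln r / (r - 1)) \<longlongrightarrow> 1) (at_right 1)" by real_asymp
    hence "\<forall>\<^sub>F r in at_right 1. ln r / (r - 1) > a" using a by (rule order_tendstoD)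
    moreover have "\<forall>\<^sub>F r::real in at_right 1. r > 1" by (simp add: eventually_at_right_less)
    ultimately have "\<forall>\<^sub>F r::real in at_right 1. ln r / (r - 1) > a \<and> r > 1" by eventually_elim auto
    then obtain r :: real where r: "r > 1" "ln r / (r - 1) > a"
      using eventually_happens by force
    \<comment> \<open>The lower bound uses the value at the right end, so here the right end M is
      given and the left end is chosen near M / r.\<close>
    define N where "N = (\<lambda>M::nat. nat \<lfloor>real M / r\<rfloor>)"
    have Nlim: "(\<lambda>M. real M / real (N M)) \<longlonglongrightarrow> r"
      unfolding N_def using r by real_asymp
    have Ntop: "filterlim N at_top sequentially"
      unfolding N_def using r by real_asymp
    have "(\<lambda>M. (s M - s (N M) + ln (real M / real (N M))) / (real M / real (N M) - 1)) \<longlonglongrightarrow> (l - l + ln r) / (r - 1)"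
      using r by (intro tendsto_intros Nlim l filterlim_compose[OF l Ntop]) auto
    hence "\<forall>\<^sub>F M in sequentially. (s M - s (N M) + ln (real M / real (N M))) / (real M / real (N M) - 1) > a"
      using r(2) by (intro order_tendstoD) auto
    moreover have "\<forall>\<^sub>F M in sequentially. real M / real (N M) > 1"
      using Nlim r(1) by (rule order_tendstoD)
    moreover have "\<forall>\<^sub>F M in sequentially. N M \<ge> 1"
      using Ntop by (simp add: filterlim_at_top)
    ultimately show "\<forall>\<^sub>F M in sequentially. a < psi M / real M"
      using eventually_ge_at_top[of 1]
    proof eventually_elim
      case (elim M)
      have MN: "N M \<le> M" "real M > real (N M)" using elim by (auto simp: field_simps)
      have "s M - s (N M) + ln (real M / real (N M)) \<le> psi M * (1 / real (N M) - 1 / real M)" 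
        using hi MN elim by auto
      also have "\<dots> = psi M / real M * (real M / real (N M) - 1)"
        using elim by (simp add: field_simps)
      finally have "(s M - s (N M) + ln (real M / real (N M))) / (real M / real (N M) - 1) \<le> psi M / real M"
        using elim MN by (subst pos_divide_le_eq) (auto simp: field_simps)
      with elim show ?case by linarith
    qed
  qed
qed

section \<open>Newman's Tauberian theorem\<close>

text \<open>A Riemann-Lebesgue lemma: one integration by parts gains a factor \<open>1 / T\<close>.\<close>

lemma contour_integral_exp_tendsto_0:
  assumes \<gamma>: "valid_path \<gamma>" "path_image \<gamma> \<subseteq> S" and S: "open S" and f: "f holomorphic_on S"
    and neg: "\<And>z. z \<in> path_image \<gamma> \<Longrightarrow> Re z \<le> 0"
    and L: "\<And>h i B. (h has_contour_integral i) \<gamma> \<Longrightarrow> 0 \<le> B \<Longrightarrow>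
              (\<And>z. z \<in> path_image \<gamma> \<Longrightarrow> norm (h z) \<le> B) \<Longrightarrow> norm i \<le> B * L"
  shows "((\<lambda>T::real. contour_integral \<gamma> (\<lambda>z. f z * exp (of_real T * z))) \<longlongrightarrow> 0) at_top"
proof -
  have f': "deriv f holomorphic_on S" using f S by (rule holomorphic_deriv)
  have cpt: "compact (path_image \<gamma>)" using \<gamma>(1) by (simp add: compact_valid_path_image)
  have "bounded (f ` path_image \<gamma>)"
    by (intro compact_imp_bounded compact_continuous_image cpt holomorphic_on_imp_continuous_on
          holomorphic_on_subset[OF f] \<gamma>)
  then obtain C where C: "\<And>z. z \<in> path_image \<gamma> \<Longrightarrow> norm (f z) \<le> C" "C > 0"
    unfolding bounded_pos by auto
  have "bounded (deriv f ` path_image \<gamma>)"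
    by (intro compact_imp_bounded compact_continuous_image cpt holomorphic_on_imp_continuous_on
          holomorphic_on_subset[OF f'] \<gamma>)
  then obtain C' where C': "\<And>z. z \<in> path_image \<gamma> \<Longrightarrow> norm (deriv f z) \<le> C'" "C' > 0"
    unfolding bounded_pos by auto
  have expb: "norm (exp (of_real T * z)) \<le> 1" if "z \<in> path_image \<gamma>" "T > 0" for T z
    using neg[OF that(1)] that(2) by (auto simp: norm_exp_eq_Re mult_nonneg_nonpos)
  have bound: "norm (contour_integral \<gamma> (\<lambda>z. f z * exp (of_real T * z))) \<le> (2 * C + C' * L) / T"
    if T: "T > 0" for T :: real
  proof -
    define F where "F = (\<lambda>z. f z * exp (of_real T * z) / of_real T)"
    define G where "G = (\<lambda>z. deriv f z * exp (of_real T * z) / of_real T)"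
    have 1: "((\<lambda>z. f z * exp (of_real T * z) + G z) has_contour_integral
               (F (pathfinish \<gamma>) - F (pathstart \<gamma>))) \<gamma>"
    proof (rule contour_integral_primitive[OF _ \<gamma>])
      fix z assume z: "z \<in> S"
      have "(f has_field_derivative deriv f z) (at z within S)"
        using f S z by (metis at_within_open holomorphic_derivI)
      thus "(F has_field_derivative f z * exp (of_real T * z) + G z) (at z within S)"
        unfolding F_def G_def using T
        by (auto intro!: derivative_eq_intros simp: field_simps)
    qed
    have "G contour_integrable_on \<gamma>"
      unfolding G_def using f f' S \<gamma> T by (intro contour_integrable_holomorphic_simple[of _ S] holomorphic_intros) auto
    then obtain J where J: "(G has_contour_integral J) \<gamma>" by (auto simp: contour_integrable_on_def)
    have "norm (G z) \<le> C' / T" if "z \<in> path_image \<gamma>" for z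
      using C'(1)[OF that] expb[OF that T] T mult_mono[of "norm (deriv f z)" C' "norm (exp (of_real T * z))" 1] less_imp_le[OF C'(2)]
      by (auto simp: G_def norm_mult norm_divide intro!: divide_right_mono)
    \<comment> \<open>The hypothesis on \<open>L\<close> is the length estimate for
      \<open>\<gamma>\<close>, kept abstract so that it can be met for arcs and for segments
      alike.\<close>
    hence nJ: "norm J \<le> C' / T * L" using C' T by (intro L[OF J]) auto
    have nF: "norm (F z) \<le> C / T" if "z \<in> path_image \<gamma>" for z
      using C(1)[OF that] expb[OF that T] T mult_mono[of "norm (f z)" C "norm (exp (of_real T * z))" 1] less_imp_le[OF C(2)]
      by (auto simp: F_def norm_mult norm_divide intro!: divide_right_mono)
    have "contour_integral \<gamma> (\<lambda>z. f z * exp (of_real T * z)) = F (pathfinish \<gamma>) - F (pathstart \<gamma>) - J"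
      using has_contour_integral_diff[OF 1 J] by (intro contour_integral_unique) simp
    also have "norm \<dots> \<le> norm (F (pathfinish \<gamma>)) + norm (F (pathstart \<gamma>)) + norm J"
      using norm_triangle_ineq4[of "F (pathfinish \<gamma>) - F (pathstart \<gamma>)" J]
        norm_triangle_ineq4[of "F (pathfinish \<gamma>)" "F (pathstart \<gamma>)"] by linarith
    also have "\<dots> \<le> C / T + C / T + C' / T * L"
      by (intro add_mono nF nJ) auto
    also have "\<dots> = (2 * C + C' * L) / T" by (simp add: add_divide_distrib)
    finally show ?thesis .
  qed
  show ?thesis
  proof (rule Lim_null_comparison)
    show "\<forall>\<^sub>F T in at_top. norm (contour_integral \<gamma> (\<lambda>z. f z * exp (of_real T * z))) \<le> (2 * C + C' * L) / T"
      using eventually_gt_at_top[of 0] by eventually_elim (rule bound)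
    show "((\<lambda>T. (2 * C + C' * L) / T) \<longlongrightarrow> 0) at_top"
      by (intro tendsto_divide_0[OF tendsto_const] filterlim_at_top_imp_at_infinity filterlim_ident)
  qed
qed

section \<open>Contour integrals over semicircles\<close>

lemma path_image_part_circlepath_0E:
  assumes "z \<in> path_image (part_circlepath 0 R a b)" "a \<le> b"
  obtains t where "z = of_real R * cis t" "t \<in> {a..b}"
proof -
  have "z \<in> (\<lambda>x. 0 + of_real R * cis x) ` {a..b}"
    using assms by (simp only: path_image_part_circlepath' closed_segment_eq_real_ivl if_True)
  then obtain t where "z = 0 + of_real R * cis t" "t \<in> {a..b}" by (rule imageE)
  thus ?thesis using that[of t] by simp
qed

lemma contour_integral_inverse_part_circlepath:
  assumes "a < b" "R > 0"
  shows "((\<lambda>z. c / z) has_contour_integral c * \<i> * of_real (b - a)) (part_circlepath 0 R a b)"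
proof -
  have "((\<lambda>t. c * \<i>) has_integral (b - a) *\<^sub>R (c * \<i>)) {a..b}"
    using has_integral_const_real[of "c * \<i>" a b] assms by simp
  moreover have "(\<lambda>t. c / (0 + of_real R * cis t) * of_real R * \<i> * cis t) = (\<lambda>t. c * \<i>)"
    using assms by (auto simp: fun_eq_iff)
  ultimately show ?thesis
    using assms by (subst has_contour_integral_part_circlepath_iff)
      (simp_all add: scaleR_conv_of_real mult_ac)
qed

text \<open>Cauchy's formula on a circle cut into two arcs. Removing \<open>f 0 / z\<close> leaves
  an entire function, whose integrals over the arcs cancel; the removed part is integrated
  explicitly and contributes \<open>f 0 * \<i>\<close> times the angle of each arc.\<close>

lemma contour_integral_two_semicircles:
  assumes f: "f holomorphic_on UNIV" and R: "R > 0"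
  shows "contour_integral (part_circlepath 0 R (-(pi/2)) (pi/2)) (\<lambda>z. f z / z)
       + contour_integral (part_circlepath 0 R (pi/2) (3*pi/2)) (\<lambda>z. f z / z) = 2 * pi * \<i> * f 0"
proof -
  let ?D1 = "part_circlepath 0 R (-(pi/2)) (pi/2)" and ?D2 = "part_circlepath 0 R (pi/2) (3*pi/2)"
  define h where "h = (\<lambda>z. if z = 0 then deriv f 0 else (f z - f 0) / (z - 0))"
  have h: "h holomorphic_on UNIV" unfolding h_def using f by (intro pole_lemma) auto
  have hi: "h contour_integrable_on ?D1" "h contour_integrable_on ?D2"
    by (rule contour_integrable_holomorphic_simple[OF h]; simp)+
  have fin: "pathfinish ?D1 = pathstart ?D2" by simp
  have st: "pathfinish ?D2 = pathstart ?D1"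
  proof -
    have "cis (3*pi/2) = cis (-(pi/2) + 2 * pi)" by simp
    also have "\<dots> = cis (-(pi/2))" unfolding cis_mult[symmetric] by simp
    finally have "cis (3*pi/2) = cis (-(pi/2))" .
    thus ?thesis by (simp add: cis_conv_exp)
  qed
  have "(h has_contour_integral 0) (?D1 +++ ?D2)"
    by (rule Cauchy_theorem_convex_simple[OF h]) (use fin st in \<open>auto intro!: valid_path_join\<close>)
  hence h0: "contour_integral ?D1 h + contour_integral ?D2 h = 0"
    using hi contour_integral_unique by fastforce
  have nz: "z \<noteq> 0" if "z \<in> path_image (part_circlepath 0 R a b)" for z a b
    using path_image_part_circlepath_subset'[of R 0 a b] that R by auto
  have *: "contour_integral (part_circlepath 0 R a b) (\<lambda>z. f z / z)
     = contour_integral (part_circlepath 0 R a b) h + f 0 * \<i> * of_real (b - a)" if "a < b" for a b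
  proof -
    have hi: "h contour_integrable_on part_circlepath 0 R a b"
      by (rule contour_integrable_holomorphic_simple[OF h]) auto
    have "((\<lambda>z. h z + f 0 / z) has_contour_integral contour_integral (part_circlepath 0 R a b) h + f 0 * \<i> * of_real (b - a))
       (part_circlepath 0 R a b)"
      by (intro has_contour_integral_add has_contour_integral_integral hi contour_integral_inverse_part_circlepath that R)
    hence "((\<lambda>z. f z / z) has_contour_integral contour_integral (part_circlepath 0 R a b) h + f 0 * \<i> * of_real (b - a))
       (part_circlepath 0 R a b)"
      by (rule has_contour_integral_eq) (use nz in \<open>auto simp: h_def diff_divide_distrib\<close>)
    thus ?thesis by (rule contour_integral_unique)
  qed
  have "contour_integral ?D1 (\<lambda>z. f z / z) + contour_integral ?D2 (\<lambda>z. f z / z)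
     = (contour_integral ?D1 h + contour_integral ?D2 h) + f 0 * \<i> * complex_of_real (pi/2 - -(pi/2) + (3*pi/2-pi/2))"
    using *[of "-(pi/2)" "pi/2"] *[of "pi/2" "3*pi/2"] by (simp add: algebra_simps)
  also have "pi/2 - -(pi/2) + (3*pi/2-pi/2) = 2 * pi" by simp
  finally show ?thesis using h0 by simp
qed

text \<open>Split off \<open>G 0 / z\<close>. The rest is holomorphic at \<open>0\<close>, so its contour can be moved to the segment on the
  imaginary axis; the contour of the first part can be moved to the left semicircle, up to the residue.\<close>

lemma right_semicircle_exp_tendsto:
  assumes U: "open U" "{z. Re z \<ge> 0} \<subseteq> U" and G: "G holomorphic_on U" and R: "R > 0"
  shows "((\<lambda>T::real. contour_integral (part_circlepath 0 R (-(pi/2)) (pi/2))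
            (\<lambda>z. G z * exp (of_real T * z) / z)) \<longlongrightarrow> 2 * pi * \<i> * G 0) at_top"
proof -
  let ?D1 = "part_circlepath 0 R (-(pi/2)) (pi/2)" and ?D2 = "part_circlepath 0 R (pi/2) (3*pi/2)"
  let ?l = "linepath (of_real R * \<i>) (-of_real R * \<i>)"
  define H where "H = {z::complex. norm z \<le> R \<and> Re z \<ge> 0}"
  have H: "convex H" "compact H" "H \<subseteq> U" "0 \<in> H" 
  proof -
    have "H = cball 0 R \<inter> {z. Re z \<ge> 0}" by (auto simp: H_def)
    moreover have "convex {z. Re z \<ge> 0}" by (rule convex_halfspace_Re_ge)
    moreover have "closed {z. Re z \<ge> 0}" by (rule closed_halfspace_Re_ge)
    ultimately show "convex H" "compact H" by (auto intro!: convex_Int compact_Int_closed)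
    show "H \<subseteq> U" "0 \<in> H" using U(2) R by (auto simp: H_def)
  qed
  have "H \<noteq> {}" using H by auto
  then obtain e where e: "e > 0" "{x. infdist x H \<le> e} \<subseteq> U"
    using compact_in_open_separated[OF _ H(2) U(1) H(3)] by blast
  \<comment> \<open>A small enough neighbourhood of the compact half disc stays in \<open>U\<close>.
    Written as a Minkowski sum with a ball it is visibly open and convex, so Cauchy's theorem for
    convex sets applies.\<close>
  define V where "V = (\<Union>x\<in>H. \<Union>y\<in>ball 0 e. {x + y})"
  have V: "convex V" "open V" unfolding V_def by (auto intro!: convex_sums open_sums H)
  have VU: "V \<subseteq> U"
  proof
    fix z assume "z \<in> V"
    then obtain x y where xy: "x \<in> H" "norm y < e" "z = x + y" by (auto simp: V_def)
    have "infdist z H \<le> dist z x" using xy by (intro infdist_le) auto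
    also have "\<dots> = norm y" using xy by (simp add: dist_norm)
    finally show "z \<in> U" using xy e by auto
  qed
  have HV: "H \<subseteq> V"
  proof
    fix z assume "z \<in> H"
    thus "z \<in> V" unfolding V_def using e by (intro UN_I[of z] UN_I[of 0]) auto
  qed
  have D1H: "path_image ?D1 \<subseteq> H"
  proof
    fix z assume "z \<in> path_image ?D1"
    then obtain t where t: "z = of_real R * cis t" "t \<in> {-(pi/2)..pi/2}"
      by (rule path_image_part_circlepath_0E) auto
    have "cos t \<ge> 0" using t by (intro cos_ge_zero) auto
    thus "z \<in> H" using t R by (auto simp: H_def norm_mult)
  qed
  have lH: "path_image ?l \<subseteq> H"
    unfolding path_image_linepath
    by (rule closed_segment_subset) (use R H in \<open>auto simp: H_def norm_mult\<close>)
  have nz: "z \<noteq> 0" if "z \<in> path_image (part_circlepath 0 R a b)" for z a b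
    using path_image_part_circlepath_subset'[of R 0 a b] that R by auto

  define Q where "Q = (\<lambda>z. if z = 0 then deriv G 0 else (G z - G 0) / (z - 0))"
  have Q: "Q holomorphic_on V" unfolding Q_def
    using V H HV by (intro pole_lemma holomorphic_on_subset[OF G VU]) (auto simp: interior_open)
  have Qe: "(\<lambda>z. Q z * exp (of_real T * z)) holomorphic_on V" for T
    by (intro holomorphic_intros Q)
  have QI: "contour_integral ?D1 (\<lambda>z. Q z * exp (of_real T * z)) = - contour_integral ?l (\<lambda>z. Q z * exp (of_real T * z))"
    and QI': "(\<lambda>z. Q z * exp (of_real T * z)) contour_integrable_on ?D1" for T
  proof -
    show 1: "(\<lambda>z. Q z * exp (of_real T * z)) contour_integrable_on ?D1"
      by (rule contour_integrable_holomorphic_simple[OF Qe V(2)]) (use D1H HV in auto)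
    have 2: "(\<lambda>z. Q z * exp (of_real T * z)) contour_integrable_on ?l"
      by (rule contour_integrable_holomorphic_simple[OF Qe V(2)]) (use lH HV in auto)
    have ends: "exp (\<i> * (complex_of_real pi / 2)) = \<i>" "exp (-(\<i> * (complex_of_real pi / 2))) = - \<i>"
      using cis_pi_half unfolding cis_conv_exp by (simp_all add: exp_minus)
    have "((\<lambda>z. Q z * exp (of_real T * z)) has_contour_integral 0) (?D1 +++ ?l)"
      by (rule Cauchy_theorem_convex_simple[OF Qe V(1)])
        (use D1H lH HV ends in \<open>auto intro!: valid_path_join simp: path_image_join\<close>)
    thus "contour_integral ?D1 (\<lambda>z. Q z * exp (of_real T * z)) = - contour_integral ?l (\<lambda>z. Q z * exp (of_real T * z))"
      using 1 2 contour_integral_unique by (fastforce simp: add_eq_0_iff)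
  qed
  have split: "contour_integral ?D1 (\<lambda>z. G z * exp (of_real T * z) / z)
     = 2 * pi * \<i> * G 0 - G 0 * contour_integral ?D2 (\<lambda>z. 1 / z * exp (of_real T * z))
        - contour_integral ?l (\<lambda>z. Q z * exp (of_real T * z))" for T
  proof -
    have E: "(\<lambda>z. exp (of_real T * z) / z) contour_integrable_on part_circlepath 0 R a b" for a b
      by (intro contour_integrable_holomorphic_simple[of _ "-{0}"] holomorphic_intros) (use nz in auto)
    have "contour_integral ?D1 (\<lambda>z. G z * exp (of_real T * z) / z)
       = contour_integral ?D1 (\<lambda>z. Q z * exp (of_real T * z) + G 0 * (exp (of_real T * z) / z))"
      by (intro contour_integral_eq) (use nz in \<open>auto simp: Q_def field_simps\<close>)
    also have "\<dots> = contour_integral ?D1 (\<lambda>z. Q z * exp (of_real T * z)) + G 0 * contour_integral ?D1 (\<lambda>z. exp (of_real T * z) / z)"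
      by (subst contour_integral_add[OF QI' contour_integrable_lmul[OF E]]) (simp only: contour_integral_lmul[OF E])
    also have "contour_integral ?D1 (\<lambda>z. exp (of_real T * z) / z) = 2 * pi * \<i> - contour_integral ?D2 (\<lambda>z. exp (of_real T * z) / z)"
      using contour_integral_two_semicircles[of "\<lambda>z. exp (of_real T * z)" R] R
      by (simp add: holomorphic_intros algebra_simps)
    finally show ?thesis unfolding QI by (simp add: algebra_simps)
  qed
  \<comment> \<open>The segment passes through 0 and the arc does not, so the part with the pole
    must go to the arc. On both contours Re z \<le> 0, as the decay lemma requires.\<close>
  have A: "((\<lambda>T::real. contour_integral ?D2 (\<lambda>z. 1 / z * exp (of_real T * z))) \<longlongrightarrow> 0) at_top"
  proof (rule contour_integral_exp_tendsto_0[of _ "-{0}" _ "R * (3*pi/2 - pi/2)"])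
    fix z assume "z \<in> path_image ?D2"
    then obtain t where t: "z = of_real R * cis t" "t \<in> {pi/2..3*pi/2}"
      by (rule path_image_part_circlepath_0E) auto
    have "cos (t - pi) \<ge> 0" using t by (intro cos_ge_zero) auto
    hence "cos t \<le> 0" by (simp add: cos_diff)
    thus "Re z \<le> 0" using t R by (auto simp: mult_nonneg_nonpos)
  next
    fix h i B assume "(h has_contour_integral i) ?D2" "0 \<le> B"
      "\<And>z. z \<in> path_image ?D2 \<Longrightarrow> norm (h z) \<le> B"
    hence "norm i \<le> B * R * (3*pi/2 - pi/2)"
      using R by (intro has_contour_integral_bound_part_circlepath[of h]) auto
    thus "norm i \<le> B * (R * (3*pi/2 - pi/2))" by (simp only: mult.assoc)
  qed (use nz in \<open>auto intro!: holomorphic_intros\<close>)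
  have B: "((\<lambda>T::real. contour_integral ?l (\<lambda>z. Q z * exp (of_real T * z))) \<longlongrightarrow> 0) at_top"
  proof (rule contour_integral_exp_tendsto_0[OF _ _ V(2) Q])
    fix z assume "z \<in> path_image ?l"
    thus "Re z \<le> 0" by (auto simp: closed_segment_def)
  next
    fix h i B assume "(h has_contour_integral i) ?l" "0 \<le> B"
      "\<And>z. z \<in> path_image ?l \<Longrightarrow> norm (h z) \<le> B"
    thus "norm i \<le> B * norm (-of_real R * \<i> - of_real R * \<i>)"
      by (intro has_contour_integral_bound_linepath) auto
  qed (use lH HV in auto)
  have "((\<lambda>T::real. 2 * pi * \<i> * G 0 - G 0 * contour_integral ?D2 (\<lambda>z. 1 / z * exp (of_real T * z))
        - contour_integral ?l (\<lambda>z. Q z * exp (of_real T * z))) \<longlongrightarrow> 2 * pi * \<i> * G 0 - G 0 * 0 - 0) at_top"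
    by (intro tendsto_intros A B)
  thus ?thesis unfolding split by simp
qed

section \<open>Newman's kernel and the Tauberian argument\<close>

text \<open>On the circle R^2 = z * cnj z, so the quotient collapses to (z + cnj z) / R^2, which is
  real.\<close>

lemma norm_newman_kernel:
  assumes "norm z = R" "R > 0"
  shows "norm ((1 + z\<^sup>2 / (of_real R)\<^sup>2) / z) = 2 * \<bar>Re z\<bar> / R\<^sup>2"
proof -
  have "of_real R ^ 2 = z * cnj z" using assms by (metis complex_norm_square of_real_power)
  moreover have "z \<noteq> 0" using assms by auto
  ultimately have "(1 + z\<^sup>2 / (of_real R)\<^sup>2) / z = (cnj z + z) / (z * cnj z)"
    by (simp add: field_simps power2_eq_square)
  also have "\<dots> = of_real (2 * Re z) / of_real (R\<^sup>2)"
    using \<open>of_real R ^ 2 = z * cnj z\<close> complex_add_cnj[of z] by (simp add: add.commute)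
  also have "norm \<dots> = 2 * \<bar>Re z\<bar> / R\<^sup>2" by (simp only: norm_divide norm_of_real) (simp add: abs_mult)
  finally show ?thesis .
qed

text \<open>Newman's factor \<open>1 + z\<^sup>2 / R\<^sup>2\<close> has size \<open>2 * \<bar>Re z\<bar> / R\<close> on \<open>norm z = R\<close>, which cancels the
  \<open>1 / \<bar>Re z\<bar>\<close> in the bounds for the tails and the partial sums.\<close>

theorem newman_tauberian:
  fixes c :: "nat \<Rightarrow> complex \<Rightarrow> complex"
  assumes c: "\<And>n. n \<ge> 1 \<Longrightarrow> c n holomorphic_on UNIV"
    and B: "B > 0"
    and bound: "\<And>n z. n \<ge> 1 \<Longrightarrow> Re z \<noteq> 0 \<Longrightarrow>
       norm (c n z) \<le> B * ((real n powr (-Re z) - real (Suc n) powr (-Re z)) / Re z)"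
    and U: "open U" "{z. Re z \<ge> 0} \<subseteq> U" and G: "G holomorphic_on U"
    and lim: "\<And>z. Re z > 0 \<Longrightarrow> (\<lambda>N. \<Sum>n\<in>{1..<N}. c n z) \<longlonglongrightarrow> G z"
  shows "(\<lambda>N. \<Sum>n\<in>{1..<N}. c n 0) \<longlonglongrightarrow> G 0"
proof -
  define g where "g = (\<lambda>N z. \<Sum>n\<in>{1..<N}. c n z)"
  have g: "g N holomorphic_on UNIV" for N
    unfolding g_def by (intro holomorphic_intros c) auto
  \<comment> \<open>The assumed bounds are the integrals of B x powr (- Re z - 1) over [n, n + 1],
    hence they telescope.\<close>
  have part: "norm (\<Sum>n\<in>{N..<M}. c n z) \<le> B * ((real N powr (-Re z) - real M powr (-Re z)) / Re z)"
    if "1 \<le> N" "N \<le> M" "Re z \<noteq> 0" for N M z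
  proof -
    have "norm (\<Sum>n\<in>{N..<M}. c n z) \<le> (\<Sum>n\<in>{N..<M}. B * ((real n powr (-Re z) - real (Suc n) powr (-Re z)) / Re z))"
      using that by (intro sum_norm_le bound) auto
    also have "\<dots> = B * (- (\<Sum>n\<in>{N..<M}. real (Suc n) powr (-Re z) - real n powr (-Re z)) / Re z)"
      by (simp add: sum_distrib_left sum_divide_distrib flip: sum_negf)
    also have "(\<Sum>n\<in>{N..<M}. real (Suc n) powr (-Re z) - real n powr (-Re z)) = real M powr (-Re z) - real N powr (-Re z)"
      using that by (intro sum_Suc_diff')
    finally show ?thesis by simp
  qed
  \<comment> \<open>Dropping the -1 left by the lower end gives the same shape as the tail bound
    \<open>g_right\<close>, so that one kernel estimate serves both half planes.\<close>
  have g_left: "norm (g N z) \<le> B * real N powr (-Re z) / \<bar>Re z\<bar>" if "N \<ge> 1" "Re z < 0" for N z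
  proof -
    have "norm (g N z) \<le> B * ((1 - real N powr (-Re z)) / Re z)"
      using part[of 1 N z] that by (simp add: g_def)
    also have "\<dots> = B * ((real N powr (-Re z) - 1) / \<bar>Re z\<bar>)" using that by (simp add: field_simps)
    also have "\<dots> \<le> B * (real N powr (-Re z) / \<bar>Re z\<bar>)"
      using B that by (intro mult_left_mono divide_right_mono) auto
    finally show ?thesis by simp
  qed
  have g_right: "norm (G z - g N z) \<le> B * real N powr (-Re z) / \<bar>Re z\<bar>" if "N \<ge> 1" "Re z > 0" for N z
  proof (rule tendsto_upperbound)
    show "(\<lambda>M. norm (g M z - g N z)) \<longlonglongrightarrow> norm (G z - g N z)"
      unfolding g_def by (intro tendsto_intros lim that)
    show "\<forall>\<^sub>F M in sequentially. norm (g M z - g N z) \<le> B * real N powr (-Re z) / \<bar>Re z\<bar>"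
      using eventually_ge_at_top[of N]
    proof eventually_elim
      case (elim M)
      have "g M z = g N z + (\<Sum>n\<in>{N..<M}. c n z)"
        unfolding g_def using that elim by (subst sum.atLeastLessThan_concat) auto
      hence "norm (g M z - g N z) \<le> B * ((real N powr (-Re z) - real M powr (-Re z)) / Re z)"
        using part[of N M z] that elim by simp
      also have "\<dots> \<le> B * (real N powr (-Re z) / Re z)"
        using B that by (intro mult_left_mono divide_right_mono) auto
      finally show ?case using that by simp
    qed
  qed auto

  \<comment> \<open>Three errors of size at most 2 pi B / R arise: the tail on the right arc, the
    partial sum on the left arc, and the distance of \<open>J\<close> from its limit, for which this
    tolerance is prescribed. Division by 2 pi gives 3 B / R.\<close>
  have main: "\<forall>\<^sub>F N in sequentially. norm (g N 0 - G 0) < 3 * B / R" if R: "R > 0" for R :: real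
  proof -
    let ?D1 = "part_circlepath 0 R (-(pi/2)) (pi/2)" and ?D2 = "part_circlepath 0 R (pi/2) (3*pi/2)"
    define K where "K = (\<lambda>z::complex. 1 + z\<^sup>2 / (of_real R)\<^sup>2)"
    have K: "K holomorphic_on S" for S unfolding K_def using R by (intro holomorphic_intros) auto
    have nz: "norm z = R" "z \<noteq> 0" if "z \<in> path_image (part_circlepath 0 R a b)" for z a b
      using path_image_part_circlepath_subset'[of R 0 a b] that R by auto
    define J where "J = (\<lambda>T::real. contour_integral ?D1 (\<lambda>z. (G z * K z) * exp (of_real T * z) / z))"
    have "(J \<longlongrightarrow> 2 * pi * \<i> * (G 0 * K 0)) at_top"
      unfolding J_def by (rule right_semicircle_exp_tendsto[OF U _ R]) (intro holomorphic_intros G K)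
    moreover have "K 0 = 1" by (simp add: K_def)
    ultimately have "(J \<longlongrightarrow> 2 * pi * \<i> * G 0) at_top" by simp
    hence "(\<lambda>N. J (ln (real N))) \<longlonglongrightarrow> 2 * pi * \<i> * G 0"
      by (rule filterlim_compose) (intro filterlim_compose[OF ln_at_top] filterlim_real_sequentially)
    hence "\<forall>\<^sub>F N in sequentially. dist (J (ln (real N))) (2 * pi * \<i> * G 0) < 2 * pi * B / R"
      by (rule tendstoD) (use B R in auto)
    thus "\<forall>\<^sub>F N in sequentially. norm (g N 0 - G 0) < 3 * B / R"
      using eventually_ge_at_top[of 1]
    proof eventually_elim
      case (elim N)
      \<comment> \<open>With this \<open>T\<close> the exponential has size N powr Re z, which
        cancels the N powr (- Re z) in both bounds.\<close>
      define T where "T = ln (real N)"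
      have expT: "norm (exp (of_real T * z)) = real N powr Re z" for z
        using elim by (simp add: norm_exp_eq_Re T_def powr_def)
      define f where "f = (\<lambda>z. g N z * K z * exp (of_real T * z))"
      have f: "f holomorphic_on UNIV" unfolding f_def by (intro holomorphic_intros g K)
      \<comment> \<open>At the two points of the circle on the imaginary axis the bounds by 1 / |Re
        z| say nothing; the estimate of an arc integral allows finitely many exceptions.\<close>
      define k where "k = {\<i> * of_real R, - \<i> * of_real R}"
      have k: "finite k" "Re z = 0 \<Longrightarrow> norm z = R \<Longrightarrow> z \<in> k" for z
      proof -
        assume z: "Re z = 0" "norm z = R"
        hence "\<bar>Im z\<bar> = R" by (simp add: cmod_def)
        thus "z \<in> k" using z by (auto simp: k_def complex_eq_iff abs_if split: if_splits)
      qed (simp add: k_def)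
      have kernel: "norm (h * K z * exp (of_real T * z) / z) \<le> 2 * B / R\<^sup>2"
        if h: "norm h \<le> B * real N powr (-Re z) / \<bar>Re z\<bar>" and z: "norm z = R" "Re z \<noteq> 0" for h z
      proof -
        have "norm (h * K z * exp (of_real T * z) / z) = norm h * (norm (K z / z) * real N powr Re z)"
          by (simp add: norm_mult norm_divide expT del: norm_exp_eq_Re)
        also have "norm (K z / z) = 2 * \<bar>Re z\<bar> / R\<^sup>2"
          unfolding K_def by (rule norm_newman_kernel[OF z(1) R])
        also have "norm h * (2 * \<bar>Re z\<bar> / R\<^sup>2 * real N powr Re z)
              \<le> (B * real N powr (-Re z) / \<bar>Re z\<bar>) * (2 * \<bar>Re z\<bar> / R\<^sup>2 * real N powr Re z)"
          by (intro mult_right_mono h) auto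
        also have "\<dots> = 2 * B / R\<^sup>2" using z elim by (simp add: powr_minus field_simps)
        finally show ?thesis .
      qed
      have fi: "(\<lambda>z. f z / z) contour_integrable_on (part_circlepath 0 R a b)" for a b
        by (intro contour_integrable_holomorphic_simple[of _ "-{0}"] holomorphic_intros holomorphic_on_subset[OF f])
           (use nz(2) in auto)
      have D1U: "path_image ?D1 \<subseteq> U - {0}" and D1Re: "\<And>z. z \<in> path_image ?D1 \<Longrightarrow> Re z \<ge> 0"
      proof -
        show *: "Re z \<ge> 0" if zin: "z \<in> path_image ?D1" for z
        proof -
          obtain t where t: "z = of_real R * cis t" "t \<in> {-(pi/2)..pi/2}"
            by (rule path_image_part_circlepath_0E[OF zin]) auto
          have "cos t \<ge> 0" using t by (intro cos_ge_zero) auto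
          thus ?thesis using t R by simp
        qed
        show "path_image ?D1 \<subseteq> U - {0}" using * U(2) nz by blast
      qed
      have D2Re: "Re z \<le> 0" if zin: "z \<in> path_image ?D2" for z
      proof -
        obtain t where t: "z = of_real R * cis t" "t \<in> {pi/2..3*pi/2}"
          by (rule path_image_part_circlepath_0E[OF zin]) auto
        have "cos (t - pi) \<ge> 0" using t by (intro cos_ge_zero) auto
        hence "cos t \<le> 0" by (simp add: cos_diff)
        thus "Re z \<le> 0" using t R by (auto simp: mult_nonneg_nonpos)
      qed
      have Gi: "(\<lambda>z. (G z * K z) * exp (of_real T * z) / z) contour_integrable_on ?D1"
        by (intro contour_integrable_holomorphic_simple[of _ "U - {0}"] holomorphic_intros
             holomorphic_on_subset[OF G] K) (use D1U U in auto)
      have "J T - contour_integral ?D1 (\<lambda>z. f z / z)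
          = contour_integral ?D1 (\<lambda>z. (G z * K z) * exp (of_real T * z) / z - f z / z)"
        unfolding J_def by (rule contour_integral_diff[OF Gi fi, symmetric])
      also have "\<dots> = contour_integral ?D1 (\<lambda>z. (G z - g N z) * K z * exp (of_real T * z) / z)"
        by (intro contour_integral_eq) (auto simp: f_def diff_divide_distrib algebra_simps)
      also have "norm \<dots> \<le> 2 * B / R\<^sup>2 * R * (pi/2 - -(pi/2))"
      proof (rule contour_integral_bound_part_circlepath_strong[OF _ k(1)])
        show "(\<lambda>z. (G z - g N z) * K z * exp (of_real T * z) / z) contour_integrable_on ?D1"
          by (intro contour_integrable_holomorphic_simple[of _ "U - {0}"] holomorphic_intros
             holomorphic_on_subset[OF G] holomorphic_on_subset[OF g] K) (use D1U U in auto)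
        fix z assume z: "z \<in> path_image ?D1 - k"
        hence "norm z = R" "Re z \<noteq> 0" "Re z \<ge> 0" using nz k(2) D1Re by auto
        thus "norm ((G z - g N z) * K z * exp (of_real T * z) / z) \<le> 2 * B / R\<^sup>2"
          using elim by (intro kernel g_right) auto
      qed (use R B in auto)
      also have "\<dots> = 2 * pi * B / R" using R by (simp add: field_simps power2_eq_square)
      finally have n1: "norm (J T - contour_integral ?D1 (\<lambda>z. f z / z)) \<le> 2 * pi * B / R" .
      have "norm (contour_integral ?D2 (\<lambda>z. f z / z)) \<le> 2 * B / R\<^sup>2 * R * (3*pi/2 - pi/2)"
      proof (rule contour_integral_bound_part_circlepath_strong[OF fi k(1)])
        fix z assume z: "z \<in> path_image ?D2 - k"
        hence "norm z = R" "Re z \<noteq> 0" "Re z \<le> 0" using nz k(2) D2Re by auto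
        thus "norm (f z / z) \<le> 2 * B / R\<^sup>2"
          unfolding f_def using elim by (intro kernel g_left) auto
      qed (use R B in auto)
      also have "\<dots> = 2 * pi * B / R" using R by (simp add: field_simps power2_eq_square)
      finally have n2: "norm (contour_integral ?D2 (\<lambda>z. f z / z)) \<le> 2 * pi * B / R" .
      have f0: "contour_integral ?D1 (\<lambda>z. f z / z) + contour_integral ?D2 (\<lambda>z. f z / z) = 2 * pi * \<i> * g N 0"
        using contour_integral_two_semicircles[OF f R] by (simp add: f_def K_def)
      have n3: "norm (J T - 2 * pi * \<i> * G 0) < 2 * pi * B / R"
        using elim by (simp add: dist_norm T_def)
      have tri: "norm (a - b + c) \<le> norm a + norm b + norm c" for a b c :: complex
        using norm_triangle_ineq[of "a - b" c] norm_triangle_ineq4[of a b] by linarith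
      \<comment> \<open>The residue formula \<open>f0\<close> turns \<open>g N 0\<close> into
        integrals over both arcs; adding and subtracting \<open>J T\<close> separates the three
        errors.\<close>
      have eq: "2 * pi * \<i> * (g N 0 - G 0) = (J T - 2 * pi * \<i> * G 0)
           - (J T - contour_integral ?D1 (\<lambda>z. f z / z)) + contour_integral ?D2 (\<lambda>z. f z / z)"
        using f0 by (simp add: algebra_simps)
      have "2 * pi * norm (g N 0 - G 0) = norm (2 * pi * \<i> * (g N 0 - G 0))"
        by (simp add: norm_mult)
      also have "\<dots> < 2 * pi * B / R + 2 * pi * B / R + 2 * pi * B / R"
        unfolding eq by (rule le_less_trans[OF tri]) (use n1 n2 n3 in linarith)
      also have "\<dots> = 2 * pi * (3 * B / R)" by (simp add: field_simps)
      finally have "2 * pi * norm (g N 0 - G 0) < 2 * pi * (3 * B / R)" .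
      thus ?case by (rule mult_left_less_imp_less) simp
    qed
  qed
  have "(\<lambda>N. g N 0) \<longlonglongrightarrow> G 0"
  proof (rule tendstoI)
    fix e :: real assume e: "e > 0"
    show "\<forall>\<^sub>F N in sequentially. dist (g N 0) (G 0) < e"
      using main[of "3 * B / e"] e B by (simp add: dist_norm)
  qed
  thus ?thesis by (simp add: g_def)
qed

section \<open>The zeta function near the line of absolute convergence\<close>

lemma norm_of_nat_powr: "norm (of_nat n powr s :: complex) = real n powr Re s"
  by (simp add: norm_powr_real_powr)

lemma norm_diff_le_derivative_bound:
  fixes f :: "real \<Rightarrow> 'a :: real_normed_vector"
  assumes "a \<le> b" and "\<And>x. a \<le> x \<Longrightarrow> x \<le> b \<Longrightarrow> (f has_vector_derivative f' x) (at x)"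
    and "\<And>x. a \<le> x \<Longrightarrow> x \<le> b \<Longrightarrow> norm (f' x) \<le> K"
  shows "norm (f b - f a) \<le> K * (b - a)"
proof (cases "a = b")
  case False
  have "norm (f b - f a) \<le> K * b - K * a"
  proof (rule differentiable_bound_general[of a b f "\<lambda>x. K * x" f' "\<lambda>_. K"])
    show "continuous_on {a..b} f"
      using assms(2) by (intro continuous_at_imp_continuous_on) (auto intro!: has_vector_derivative_continuous[OF assms(2)])
    show "((*) K has_vector_derivative K) (at x)" for x
      by (auto intro!: derivative_eq_intros simp: has_real_derivative_iff_has_vector_derivative[symmetric])
  qed (use assms False in \<open>auto intro!: continuous_intros\<close>)
  thus ?thesis by (simp add: algebra_simps)
qed auto

lemma has_vector_derivative_of_real_powr:
  assumes "x > 0"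
  shows "((\<lambda>x. of_real x powr w :: complex) has_vector_derivative w * of_real x powr (w - 1)) (at x)"
  using assms by (intro has_vector_derivative_real_field has_field_derivative_powr) auto

lemma summable_ln_powr:
  assumes "\<sigma> > (1::real)"
  shows "summable (\<lambda>n. ln (real n) * real n powr (-\<sigma>))"
proof (rule summable_comparison_test)
  \<comment> \<open>Half of the room above exponent 1 is spent on ln n \<le> n powr e / e; the other
    half keeps the series summable.\<close>
  define e where "e = (\<sigma> - 1) / 2"
  have e: "e > 0" "e - \<sigma> < -1" using assms by (auto simp: e_def field_simps)
  show "summable (\<lambda>n. real n powr (e - \<sigma>) * (1 / e))"
    by (intro summable_mult2) (use e in \<open>simp add: summable_real_powr_iff\<close>)
  show "\<exists>N. \<forall>n\<ge>N. norm (ln (real n) * real n powr (-\<sigma>)) \<le> real n powr (e - \<sigma>) * (1 / e)"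
  proof (intro exI allI impI)
    fix n :: nat assume n: "n \<ge> 1"
    have "norm (ln (real n) * real n powr (-\<sigma>)) = ln (real n) * real n powr (-\<sigma>)" using n by simp
    also have "\<dots> \<le> real n powr e / e * real n powr (-\<sigma>)"
      using n e by (intro mult_right_mono ln_powr_bound) auto
    also have "\<dots> = real n powr (e - \<sigma>) * (1 / e)"
      by (simp add: powr_add[symmetric] divide_simps)
    finally show "norm (ln (real n) * real n powr (-\<sigma>)) \<le> real n powr (e - \<sigma>) * (1 / e)" .
  qed
qed

text \<open>In the next two series the term for \<open>n = 0\<close> vanishes because \<open>0 powr w = 0\<close>.\<close>

definition zeta_series :: "complex \<Rightarrow> complex" where
  "zeta_series s = (\<Sum>n. of_nat n powr (-s))"

definition mangoldt_series :: "complex \<Rightarrow> complex" where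
  "mangoldt_series s = (\<Sum>n. mangoldt n * of_nat n powr (-s))"

lemma summable_norm_zeta_series:
  "Re s > 1 \<Longrightarrow> summable (\<lambda>n. norm (of_nat n powr (-s) :: complex))"
  by (simp add: norm_of_nat_powr summable_real_powr_iff)

lemma norm_mangoldt_series_term_le:
  "norm (mangoldt n * of_nat n powr (-s) :: complex) \<le> ln (real n) * real n powr (-Re s)"
  by (cases "n = 0") (auto simp: norm_mult norm_of_nat_powr intro!: mult_right_mono mangoldt_le)

lemma summable_norm_mangoldt_series:
  assumes "Re s > 1"
  shows "summable (\<lambda>n. norm (mangoldt n * of_nat n powr (-s) :: complex))"
  by (rule summable_comparison_test[OF _ summable_ln_powr[OF assms]])
    (use norm_mangoldt_series_term_le in \<open>auto intro!: exI[of _ 0]\<close>)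

lemma mangoldt_series_sums:
  "Re s > 1 \<Longrightarrow> (\<lambda>n. mangoldt n * of_nat n powr (-s)) sums mangoldt_series s"
  unfolding mangoldt_series_def
  by (intro summable_sums summable_norm_cancel[OF summable_norm_mangoldt_series])

text \<open>Boundedness to the right of \<open>\<sigma>\<close> excludes zeros with Re s > 1: at a
  zero the series would have a pole.\<close>

lemma norm_mangoldt_series_le:
  assumes "1 < \<sigma>" "\<sigma> \<le> Re s"
  shows "norm (mangoldt_series s) \<le> (\<Sum>n. ln (real n) * real n powr (-\<sigma>))"
proof -
  have "norm (mangoldt_series s) \<le> (\<Sum>n. norm (mangoldt n * of_nat n powr (-s) :: complex))"
    unfolding mangoldt_series_def by (rule summable_norm[OF summable_norm_mangoldt_series]) (use assms in auto)
  also have "\<dots> \<le> (\<Sum>n. ln (real n) * real n powr (-\<sigma>))"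
  proof (rule suminf_le)
    fix n
    have "ln (real n) * real n powr (-Re s) \<le> ln (real n) * real n powr (-\<sigma>)"
      using assms by (cases "n = 0") (auto intro!: mult_left_mono powr_mono)
    thus "norm (mangoldt n * of_nat n powr (-s) :: complex) \<le> ln (real n) * real n powr (-\<sigma>)"
      using norm_mangoldt_series_term_le[of n s] by linarith
  qed (use assms summable_norm_mangoldt_series summable_ln_powr in auto)
  finally show ?thesis .
qed

section \<open>The logarithmic derivative of zeta\<close>

text \<open>The Dirichlet product of 1 and \<open>mangoldt\<close> is \<open>ln\<close>. The
  absolutely summable double family is reindexed by n = m * d and summed over the divisors d of
  n.\<close>

lemma zeta_series_times_mangoldt_series:
  assumes s: "Re s > 1"
  shows "(\<lambda>n. of_real (ln (real n)) * of_nat n powr (-s)) sums (zeta_series s * mangoldt_series s)"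
proof -
  define a where "a = (\<lambda>n::nat. of_nat n powr (-s) :: complex)"
  define b where "b = (\<lambda>n::nat. mangoldt n * of_nat n powr (-s) :: complex)"
  have sa: "summable (\<lambda>n. norm (a n))" and sb: "summable (\<lambda>n. norm (b n))"
    using summable_norm_zeta_series[OF s] summable_norm_mangoldt_series[OF s] by (simp_all add: a_def b_def)
  have a0 [simp]: "a 0 = 0" and b0 [simp]: "b 0 = 0" by (simp_all add: a_def b_def)
  have A: "(a has_sum zeta_series s) UNIV" 
    using norm_summable_imp_has_sum[OF sa] summable_sums[OF summable_norm_cancel[OF sa]]
    by (simp add: zeta_series_def a_def)
  have B: "(b has_sum mangoldt_series s) UNIV"
    using norm_summable_imp_has_sum[OF sb] summable_sums[OF summable_norm_cancel[OF sb]]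
    by (simp add: mangoldt_series_def b_def)
  \<comment> \<open>The vanishing terms at index 0 are dropped, because (m, d) \<mapsto> (m * d, d)
    is a bijection onto pairs of a number and a divisor only for positive numbers.\<close>
  have A': "(a has_sum zeta_series s) {1..}"
    using A by (rule has_sum_cong_neutral[THEN iffD1, rotated -1]) (auto simp: not_le)
  have B': "(b has_sum mangoldt_series s) {1..}"
    using B by (rule has_sum_cong_neutral[THEN iffD1, rotated -1]) (auto simp: not_le)
  have aA: "(\<lambda>n. norm (a n)) summable_on {1..}" and bB: "(\<lambda>n. norm (b n)) summable_on {1..}"
    using A' B' by (auto simp: summable_on_iff_abs_summable_on_complex[symmetric] summable_on_def)
  have "(\<lambda>(m,d). a m * b d) summable_on ({1..} \<times> {1..})"
  proof -
    have "(\<lambda>x. norm (case x of (m,d) \<Rightarrow> a m * b d)) summable_on ({1..} \<times> {1..})"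
      using aA bB
      by (subst Infinite_Sum.abs_summable_on_Sigma_iff)
         (auto simp: norm_mult abs_mult infsum_cmult_right' intro!: summable_on_cmult_right summable_on_cmult_left infsum_nonneg)
    thus ?thesis by (rule Infinite_Sum.abs_summable_summable)
  qed
  hence "((\<lambda>(m,d). a m * b d) has_sum (zeta_series s * mangoldt_series s)) ({1..} \<times> {1..})"
    by (intro has_sum_SigmaI[where g = "\<lambda>m. a m * mangoldt_series s"])
       (use A' B' in \<open>auto intro!: has_sum_cmult_right has_sum_cmult_left\<close>)
  also have "?this \<longleftrightarrow> ((\<lambda>(n,d). mangoldt d * of_nat n powr (-s)) has_sum (zeta_series s * mangoldt_series s))
       (SIGMA n:{1..}. {d. d dvd n})"
    by (rule has_sum_reindex_bij_witness[of _ "\<lambda>(n,d). (n div d, d)" "\<lambda>(m,d). (m * d, d)"])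
       (auto simp: a_def b_def powr_times_real Suc_le_eq dvd_div_mult_self dest: dvd_imp_le intro!: Nat.gr0I)
  finally have "((\<lambda>n. of_real (ln (real n)) * of_nat n powr (-s)) has_sum (zeta_series s * mangoldt_series s)) {1..}"
  proof (rule has_sum_SigmaD)
    fix n :: nat assume n: "n \<in> {1..}"
    hence "(\<Sum>d | d dvd n. mangoldt d * of_nat n powr (-s)) = of_real (ln (real n)) * (of_nat n powr (-s) :: complex)"
      using mangoldt_sum[of n, where ?'a = complex] by (simp flip: sum_distrib_right)
    thus "((\<lambda>d. case (n, d) of (n, d) \<Rightarrow> mangoldt d * of_nat n powr (-s)) has_sum
             of_real (ln (real n)) * of_nat n powr (-s)) {d. d dvd n}"
      using n by (intro has_sum_finiteI) auto
  qed
  hence "((\<lambda>n. of_real (ln (real n)) * of_nat n powr (-s)) has_sum (zeta_series s * mangoldt_series s)) UNIV"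
    by (rule has_sum_cong_neutral[THEN iffD1, rotated -1]) (auto simp: not_le)
  thus ?thesis by (rule has_sum_imp_sums)
qed

text \<open>Termwise differentiation brings down - ln n and leads to the product just computed. The
  product form avoids dividing by a value not yet known to be nonzero.\<close>

lemma zeta_series_has_field_derivative:
  assumes s: "Re s > 1"
  shows "(zeta_series has_field_derivative - (zeta_series s * mangoldt_series s)) (at s)"
proof -
  define S where "S = {s. Re s > 1}"
  have S: "open S" unfolding S_def by (rule open_halfspace_Re_gt)
  have "\<exists>g g'. \<forall>x\<in>S. ((\<lambda>n. of_nat n powr (-x)) sums g x) \<and>
        ((\<lambda>n. - (of_real (ln (real n)) * of_nat n powr (-x))) sums g' x) \<and> (g has_field_derivative g' x) (at x)"
  proof (rule series_and_derivative_comparison_complex[OF S])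
    fix n :: nat and x :: complex
    show "((\<lambda>x. of_nat n powr (-x)) has_field_derivative - (of_real (ln (real n)) * of_nat n powr (-x))) (at x)"
    proof (cases "n = 0")
      case False
      have "((\<lambda>x. of_nat n powr (-x)) has_field_derivative (Ln (of_nat n) * of_nat n powr (-x)) * (-1)) (at x)"
        using False by (intro DERIV_chain2[where g = uminus] has_field_derivative_powr_right)
          (auto intro!: derivative_eq_intros)
      thus ?thesis using False by (simp add: Ln_of_nat)
    qed auto
  next
    fix x assume "x \<in> S"
    hence x: "Re x > 1" by (simp add: S_def)
    \<comment> \<open>The midpoint of 1 and Re x: on the ball of radius Re x - r all real parts
      exceed r > 1, which gives a summable majorant.\<close>
    define r where "r = (Re x + 1) / 2"
    show "\<exists>d h. 0 < d \<and> summable h \<and> range h \<subseteq> \<real>\<^sub>\<ge>\<^sub>0 \<and>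
        (\<forall>\<^sub>F n in sequentially. \<forall>y\<in>ball x d \<inter> S. cmod (of_nat n powr (-y)) \<le> cmod (h n))"
    proof (intro exI[of _ "Re x - r"] exI[of _ "\<lambda>n. of_real (real n powr (-r))"] conjI)
      show "0 < Re x - r" using x by (simp add: r_def field_simps)
      show "summable (\<lambda>n. complex_of_real (real n powr (-r)))"
        using x by (subst summable_complex_of_real) (simp add: summable_real_powr_iff r_def)
      show "\<forall>\<^sub>F n in sequentially. \<forall>y\<in>ball x (Re x - r) \<inter> S.
              cmod (of_nat n powr (-y)) \<le> cmod (complex_of_real (real n powr (-r)))"
        using eventually_ge_at_top[of 1]
      proof eventually_elim
        case (elim n)
        have "real n powr (-Re y) \<le> real n powr (-r)" if "y \<in> ball x (Re x - r)" for y
          using that elim abs_Re_le_cmod[of "x - y"] by (intro powr_mono) (auto simp: dist_norm)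
        thus ?case by (simp add: norm_of_nat_powr)
      qed
    qed auto
  qed
  then obtain g g' where g: "\<And>x. x \<in> S \<Longrightarrow> (\<lambda>n. of_nat n powr (-x)) sums g x"
      "\<And>x. x \<in> S \<Longrightarrow> (\<lambda>n. - (of_real (ln (real n)) * of_nat n powr (-x))) sums g' x"
      "\<And>x. x \<in> S \<Longrightarrow> (g has_field_derivative g' x) (at x)" by blast
  have sS: "s \<in> S" using s by (simp add: S_def)
  have eq: "g x = zeta_series x" if "x \<in> S" for x
    using g(1)[OF that] by (simp add: zeta_series_def sums_iff)
  have "g' s = - (zeta_series s * mangoldt_series s)"
    using sums_unique2[OF g(2)[OF sS] sums_minus[OF zeta_series_times_mangoldt_series[OF s]]] by simp
  thus ?thesis
    using has_field_derivative_transform_within_open[OF g(3)[OF sS] S sS eq] by simp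
qed

text \<open>\<open>reg_zeta\<close> continues \<open>(s - 1) * zeta s\<close>: the differences of the powers with exponent \<open>1 - s\<close>
  telescope to \<open>-1\<close> and make the terms of order \<open>n powr (- s - 1)\<close>. The factor \<open>s - 1\<close> removes the pole.\<close>

definition reg_zeta_term :: "nat \<Rightarrow> complex \<Rightarrow> complex" where
  "reg_zeta_term n s = (s - 1) * of_nat n powr (-s) + of_nat (Suc n) powr (1 - s) - of_nat n powr (1 - s)"

definition reg_zeta :: "complex \<Rightarrow> complex" where
  "reg_zeta s = 1 + (\<Sum>n. reg_zeta_term (Suc n) s)"

text \<open>The term equals (s - 1) times the integral of n powr (-s) - x powr (-s) over [n, n + 1].
  One mean value estimate bounds the integrand by \<open>K\<close>, a second one the increment of
  the primitive \<open>F\<close>.\<close>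

lemma norm_reg_zeta_term_le:
  assumes n: "n \<ge> 1" and s: "Re s > 0"
  shows "norm (reg_zeta_term n s) \<le> norm (s - 1) * norm s * real n powr (-Re s - 1)"
proof -
  define K where "K = norm s * real n powr (-Re s - 1)"
  have inner: "norm (of_real x powr (-s) - of_real (real n) powr (-s)) \<le> K" if x: "real n \<le> x" "x \<le> real n + 1" for x
  proof -
    have "norm (of_real x powr (-s) - of_real (real n) powr (-s)) \<le> K * (x - real n)"
    proof (rule norm_diff_le_derivative_bound[OF x(1)])
      fix y assume y: "real n \<le> y" "y \<le> x"
      show "((\<lambda>x. of_real x powr (-s)) has_vector_derivative (-s) * of_real y powr (-s - 1)) (at y)"
        using y n by (intro has_vector_derivative_of_real_powr) auto
      have "norm (-s * of_real y powr (-s - 1)) = norm s * y powr (-Re s - 1)"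
        using y n by (simp add: norm_mult norm_powr_real_powr)
      also have "\<dots> \<le> K" unfolding K_def using y n s by (intro mult_left_mono powr_mono2') auto
      finally show "norm (-s * of_real y powr (-s - 1)) \<le> K" .
    qed
    also have "\<dots> \<le> K * 1" using x by (intro mult_left_mono) (auto simp: K_def)
    finally show ?thesis by simp
  qed
  define F where "F = (\<lambda>x::real. (s - 1) * (of_real x * of_real (real n) powr (-s)) + of_real x powr (1 - s))"
  have "norm (F (real n + 1) - F (real n)) \<le> norm (s - 1) * K * (real n + 1 - real n)"
  proof (rule norm_diff_le_derivative_bound)
    fix x assume x: "real n \<le> x" "x \<le> real n + 1"
    have "((\<lambda>x. (s - 1) * (of_real x * of_real (real n) powr (-s))) has_vector_derivative
             (s - 1) * of_real (real n) powr (-s)) (at x)"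
      by (rule has_vector_derivative_real_field) (auto intro!: derivative_eq_intros)
    moreover have "((\<lambda>x. of_real x powr (1 - s)) has_vector_derivative (1 - s) * of_real x powr (1 - s - 1)) (at x)"
      using x n by (intro has_vector_derivative_of_real_powr) auto
    ultimately have "(F has_vector_derivative (s - 1) * of_real (real n) powr (-s) + (1 - s) * of_real x powr (1 - s - 1)) (at x)"
      unfolding F_def by (rule has_vector_derivative_add)
    thus "(F has_vector_derivative - (s - 1) * (of_real x powr (-s) - of_real (real n) powr (-s))) (at x)"
      by (simp add: algebra_simps)
    show "norm (- (s - 1) * (of_real x powr (-s) - of_real (real n) powr (-s))) \<le> norm (s - 1) * K"
      unfolding norm_mult norm_minus_cancel by (intro mult_left_mono inner x) auto
  qed simp
  also have "F (real n + 1) - F (real n) = reg_zeta_term n s"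
    unfolding F_def reg_zeta_term_def by (simp add: algebra_simps)
  finally show ?thesis by (simp add: K_def mult.assoc)
qed

lemma reg_zeta_holomorphic: "reg_zeta holomorphic_on {s. Re s > 0}"
proof -
  define S where "S = {s. Re s > 0}"
  have S: "open S" unfolding S_def by (rule open_halfspace_Re_gt)
  have "\<exists>g g'. \<forall>x\<in>S. ((\<lambda>n. reg_zeta_term (Suc n) x) sums g x) \<and>
        ((\<lambda>n. deriv (reg_zeta_term (Suc n)) x) sums g' x) \<and> (g has_field_derivative g' x) (at x)"
  proof (rule series_and_derivative_comparison_complex[OF S])
    fix n :: nat and x :: complex
    have "reg_zeta_term (Suc n) holomorphic_on UNIV"
      unfolding reg_zeta_term_def by (intro holomorphic_intros)
    thus "(reg_zeta_term (Suc n) has_field_derivative deriv (reg_zeta_term (Suc n)) x) (at x)"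
      by (rule holomorphic_derivI) auto
  next
    fix x assume "x \<in> S"
    hence x: "Re x > 0" by (simp add: S_def)
    \<comment> \<open>On the ball of this radius Re y \<ge> r and norm y \<le> A, so the term bound
      becomes uniform and summable.\<close>
    define r where "r = Re x / 2"
    define A where "A = norm x + r"
    have r: "r > 0" using x by (simp add: r_def)
    show "\<exists>d h. 0 < d \<and> summable h \<and> range h \<subseteq> \<real>\<^sub>\<ge>\<^sub>0 \<and>
        (\<forall>\<^sub>F n in sequentially. \<forall>y\<in>ball x d \<inter> S. cmod (reg_zeta_term (Suc n) y) \<le> cmod (h n))"
    proof (intro exI[of _ r] exI[of _ "\<lambda>n. of_real ((A + 1) * A * real (Suc n) powr (-r - 1))"] conjI)
      have "summable (\<lambda>n. real (Suc n) powr (-r - 1))"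
        using r by (subst summable_Suc_iff) (simp add: summable_real_powr_iff)
      thus "summable (\<lambda>n. complex_of_real ((A + 1) * A * real (Suc n) powr (-r - 1)))"
        by (subst summable_complex_of_real) (intro summable_mult)
      have A: "A \<ge> 0" using r by (auto simp: A_def)
      thus "range (\<lambda>n. complex_of_real ((A + 1) * A * real (Suc n) powr (-r - 1))) \<subseteq> \<real>\<^sub>\<ge>\<^sub>0" by auto
      show "\<forall>\<^sub>F n in sequentially. \<forall>y\<in>ball x r \<inter> S.
              cmod (reg_zeta_term (Suc n) y) \<le> cmod (complex_of_real ((A + 1) * A * real (Suc n) powr (-r - 1)))"
      proof (intro always_eventually allI ballI)
        fix n y assume "y \<in> ball x r \<inter> S"
        hence y: "norm (x - y) < r" by (auto simp: dist_norm)
        have ry: "Re y \<ge> r" using y abs_Re_le_cmod[of "x - y"] by (auto simp: r_def)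
        have yA: "norm y \<le> A" using y norm_triangle_ineq2[of y x] by (auto simp: A_def norm_minus_commute)
        have "norm (reg_zeta_term (Suc n) y) \<le> norm (y - 1) * norm y * real (Suc n) powr (-Re y - 1)"
          using ry r by (intro norm_reg_zeta_term_le) auto
        also have "\<dots> \<le> (A + 1) * A * real (Suc n) powr (-r - 1)"
        proof (intro mult_mono powr_mono)
          show "norm (y - 1) \<le> A + 1" using yA norm_triangle_ineq4[of y 1] by simp
        qed (use yA ry A in auto)
        also have "\<dots> = cmod (complex_of_real ((A + 1) * A * real (Suc n) powr (-r - 1)))"
          using A by (simp only: norm_of_real abs_of_nonneg mult_nonneg_nonneg powr_ge_zero add_nonneg_nonneg zero_le_one)
        finally show "cmod (reg_zeta_term (Suc n) y) \<le> cmod (complex_of_real ((A + 1) * A * real (Suc n) powr (-r - 1)))" .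
      qed
    qed (use r in auto)
  qed
  then obtain g g' where g: "\<And>x. x \<in> S \<Longrightarrow> (\<lambda>n. reg_zeta_term (Suc n) x) sums g x"
      "\<And>x. x \<in> S \<Longrightarrow> (g has_field_derivative g' x) (at x)" by blast
  have "g holomorphic_on S" using g(2) S by (auto simp: holomorphic_on_open)
  hence "(\<lambda>x. 1 + g x) holomorphic_on S" by (intro holomorphic_intros)
  also have "?this \<longleftrightarrow> reg_zeta holomorphic_on S"
    using g(1) by (intro holomorphic_cong) (auto simp: reg_zeta_def sums_iff)
  finally show ?thesis by (simp add: S_def)
qed

text \<open>This is the residue of zeta at its pole. It later shows that 1 is no zero and that
  \<open>reg_zeta\<close> cannot be constant if it vanishes somewhere.\<close>

lemma reg_zeta_1: "reg_zeta 1 = 1"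
proof -
  have "reg_zeta_term (Suc n) 1 = 0" for n
    unfolding reg_zeta_term_def using of_nat_neq_0[of n] of_nat_neq_0[of "Suc n"] by (simp del: of_nat_Suc)
  thus ?thesis by (simp add: reg_zeta_def)
qed

lemma tendsto_of_nat_powr_0:
  assumes "Re w < 0"
  shows "(\<lambda>n. of_nat n powr w :: complex) \<longlonglongrightarrow> 0"
proof (rule tendsto_norm_zero_cancel)
  have "((\<lambda>n. real n powr Re w) \<longlonglongrightarrow> 0)"
    using assms by (intro tendsto_neg_powr filterlim_real_sequentially)
  thus "(\<lambda>n. norm (of_nat n powr w :: complex)) \<longlonglongrightarrow> 0" by (simp add: norm_of_nat_powr)
qed

lemma reg_zeta_conv_zeta_series:
  assumes s: "Re s > 1"
  shows "reg_zeta s = (s - 1) * zeta_series s"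
proof -
  have zs: "(\<lambda>n. of_nat n powr (-s)) sums zeta_series s"
    unfolding zeta_series_def by (intro summable_sums summable_norm_cancel[OF summable_norm_zeta_series[OF s]])
  hence "(\<lambda>n. of_nat (Suc n) powr (-s)) sums zeta_series s"
    using sums_Suc_iff[of "\<lambda>n. of_nat n powr (-s) :: complex" "zeta_series s"] by simp
  hence 1: "(\<lambda>n. (s - 1) * of_nat (Suc n) powr (-s)) sums ((s - 1) * zeta_series s)"
    by (rule sums_mult)
  have "(\<lambda>n. of_nat (Suc n) powr (1 - s) :: complex) \<longlonglongrightarrow> 0"
    using s by (intro filterlim_compose[OF tendsto_of_nat_powr_0 filterlim_Suc]) auto
  hence "(\<lambda>n. of_nat (Suc (Suc n)) powr (1 - s) - of_nat (Suc n) powr (1 - s) :: complex) sums (0 - of_nat (Suc 0) powr (1 - s))"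
    by (rule telescope_sums)
  from sums_add[OF 1 this] have "(\<lambda>n. reg_zeta_term (Suc n) s) sums ((s - 1) * zeta_series s - 1)"
    by (simp add: reg_zeta_term_def algebra_simps)
  thus ?thesis by (simp add: reg_zeta_def sums_iff)
qed

text \<open>The product rule, with 1 / (s - 1) coming from the factor that removes the pole. It is
  multiplied out because it is used before zeros have been excluded.\<close>

lemma deriv_reg_zeta:
  assumes s: "Re s > 1"
  shows "deriv reg_zeta s = reg_zeta s * (1 / (s - 1) - mangoldt_series s)"
proof -
  have "((\<lambda>s. (s - 1) * zeta_series s) has_field_derivative
          (s - 1) * (- (zeta_series s * mangoldt_series s)) + 1 * zeta_series s) (at s)"
    by (rule DERIV_mult') (auto intro!: derivative_eq_intros zeta_series_has_field_derivative s)
  hence "(reg_zeta has_field_derivative (s - 1) * (- (zeta_series s * mangoldt_series s)) + 1 * zeta_series s) (at s)"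
    by (rule has_field_derivative_transform_within_open[of _ _ _ "{s. Re s > 1}"])
       (use s reg_zeta_conv_zeta_series in \<open>auto simp: open_halfspace_Re_gt\<close>)
  moreover have "s \<noteq> 1" using s by auto
  ultimately show ?thesis
    using s by (subst DERIV_imp_deriv) (auto simp: reg_zeta_conv_zeta_series field_simps)
qed

section \<open>Nonvanishing for Re s \<ge> 1\<close>

lemma open_reg_zeta_nonzero: "open {s. Re s > 0 \<and> reg_zeta s \<noteq> 0}"
proof -
  have "open ({s. Re s > 0} \<inter> reg_zeta -` (-{0}))"
    by (intro continuous_open_preimage holomorphic_on_imp_continuous_on reg_zeta_holomorphic open_halfspace_Re_gt) auto
  also have "{s. Re s > 0} \<inter> reg_zeta -` (-{0}) = {s. Re s > 0 \<and> reg_zeta s \<noteq> 0}" by auto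
  finally show ?thesis .
qed

lemma reg_zeta_local_factorization:
  assumes "Re a > 0"
  obtains m r g where "r > 0" "ball a r \<subseteq> {s. Re s > 0}" "g holomorphic_on ball a r"
    "\<And>w. w \<in> ball a r \<Longrightarrow> reg_zeta w = (w - a) ^ m * g w" "\<And>w. w \<in> ball a r \<Longrightarrow> g w \<noteq> 0"
    "m > 0 \<longleftrightarrow> reg_zeta a = 0"
proof (cases "reg_zeta a = 0")
  case True
  have nc: "\<not> reg_zeta constant_on {s. Re s > 0}"
  proof
    assume "reg_zeta constant_on {s. Re s > 0}"
    hence "reg_zeta a = reg_zeta 1" using assms unfolding constant_on_def by force
    thus False using True reg_zeta_1 by simp
  qed
  obtain g r m where "0 < m" "0 < r" "ball a r \<subseteq> {s. Re s > 0}" "g holomorphic_on ball a r"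
    "\<And>w. w \<in> ball a r \<Longrightarrow> reg_zeta w = (w - a) ^ m * g w" "\<And>w. w \<in> ball a r \<Longrightarrow> g w \<noteq> 0"
    by (rule holomorphic_factor_zero_nonconstant[OF reg_zeta_holomorphic open_halfspace_Re_gt
          convex_connected[OF convex_halfspace_Re_gt], of a])
       (use assms True in simp, rule True, rule nc, rule that)
  thus ?thesis using that[of r g m] True by auto
next
  case False
  then obtain r where r: "r > 0" "ball a r \<subseteq> {s. Re s > 0 \<and> reg_zeta s \<noteq> 0}"
    using open_reg_zeta_nonzero assms by (metis (mono_tags, lifting) mem_Collect_eq open_contains_ball)
  have sub: "ball a r \<subseteq> {s. Re s > 0}" using r by blast
  have nz: "reg_zeta w \<noteq> 0" if "w \<in> ball a r" for w
    using r that by blast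
  have hol: "reg_zeta holomorphic_on ball a r" using sub by (rule holomorphic_on_subset[OF reg_zeta_holomorphic])
  show ?thesis
    by (intro that[of r reg_zeta 0] r(1) sub hol nz) (use False in simp_all)
qed

text \<open>Approaching \<open>a\<close> from the right, d times a logarithmic derivative tends to
  the order at \<open>a\<close>. A zero of multiplicity m contributes - m, and the pole of zeta at 1
  contributes 1.\<close>

lemma mangoldt_series_boundary_limit:
  assumes a: "Re a \<ge> 1"
  obtains m :: nat where "m > 0 \<longleftrightarrow> reg_zeta a = 0"
    "((\<lambda>d. of_real d * mangoldt_series (a + of_real d)) \<longlongrightarrow> (if a = 1 then 1 else 0) - of_nat m) (at_right 0)"
proof -
  have a0: "Re a > 0" using a by simp
  obtain m r g where r: "r > 0" "ball a r \<subseteq> {s. Re s > 0}" and g: "g holomorphic_on ball a r"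
    and Zg: "\<And>w. w \<in> ball a r \<Longrightarrow> reg_zeta w = (w - a) ^ m * g w" and nz: "\<And>w. w \<in> ball a r \<Longrightarrow> g w \<noteq> 0"
    and m: "m > 0 \<longleftrightarrow> reg_zeta a = 0"
    by (rule reg_zeta_local_factorization[OF a0]) (rule that)
  have ident: "of_real d * mangoldt_series (a + of_real d)
      = of_real d / (a + of_real d - 1) - of_nat m - of_real d * (deriv g (a + of_real d) / g (a + of_real d))"
    if d: "d > 0" "d < r" for d
  proof -
    define w where "w = a + of_real d"
    have w: "w \<in> ball a r" "Re w > 1" "w - a = of_real d"
      using d a by (auto simp: w_def dist_norm)
    have w1: "w \<noteq> 1" using w(2) by auto
    have "(g has_field_derivative deriv g w) (at w)"
      using g w by (intro holomorphic_derivI[OF g]) auto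
    hence "((\<lambda>w. (w - a) ^ m * g w) has_field_derivative
             (w - a) ^ m * deriv g w + of_nat m * (w - a) ^ (m - 1) * g w) (at w)"
      by (auto intro!: derivative_eq_intros)
    hence "(reg_zeta has_field_derivative (w - a) ^ m * deriv g w + of_nat m * (w - a) ^ (m - 1) * g w) (at w)"
      by (rule has_field_derivative_transform_within_open[of _ _ _ "ball a r"]) (use w Zg in auto)
    hence "deriv reg_zeta w = (w - a) ^ m * deriv g w + of_nat m * (w - a) ^ (m - 1) * g w"
      by (rule DERIV_imp_deriv)
    hence "of_real d * ((w - a) ^ m * g w * (1 / (w - 1) - mangoldt_series w))
         = of_real d * ((w - a) ^ m * deriv g w) + of_nat m * (of_real d * (w - a) ^ (m - 1)) * g w"
      using deriv_reg_zeta[OF w(2)] Zg[OF w(1)] by (simp add: algebra_simps)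
    \<comment> \<open>Since w - a = d, one power is regained; for m = 0 the truncated exponent is
      harmless because of the factor m.\<close>
    also have "of_nat m * (of_real d * (w - a) ^ (m - 1)) = of_nat m * (w - a) ^ m"
      unfolding w(3) by (cases m) auto
    finally have "(w - a) ^ m * (of_real d * (g w * (1 / (w - 1) - mangoldt_series w)))
         = (w - a) ^ m * (of_real d * deriv g w + of_nat m * g w)"
      by (simp add: algebra_simps)
    hence "of_real d * (g w * (1 / (w - 1) - mangoldt_series w)) = of_real d * deriv g w + of_nat m * g w"
      using d w(3) by simp
    hence "of_real d * mangoldt_series w = of_real d / (w - 1) - of_nat m - of_real d * (deriv g w / g w)"
      using nz[OF w(1)] w1 by (simp add: field_simps)
    thus ?thesis by (simp add: w_def)
  qed
  have lim_d: "((\<lambda>d. complex_of_real d) \<longlongrightarrow> 0) (at_right 0)"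
    by (auto intro!: tendsto_eq_intros)
  have lim_a: "((\<lambda>d. a + complex_of_real d) \<longlongrightarrow> a) (at_right 0)"
    by (auto intro!: tendsto_eq_intros)
  have ar: "a \<in> ball a r" using r by simp
  have cg: "isCont g a" and cg': "isCont (deriv g) a"
    using holomorphic_on_imp_continuous_on[OF g] holomorphic_on_imp_continuous_on[OF holomorphic_deriv[OF g open_ball]] ar
    by (auto simp: continuous_on_eq_continuous_at)
  have "((\<lambda>d. of_real d / (a + of_real d - 1)) \<longlongrightarrow> (if a = 1 then 1 else 0)) (at_right 0)"
  proof (cases "a = 1")
    case True
    have "((\<lambda>d. 1::complex) \<longlongrightarrow> 1) (at_right (0::real))" by simp
    moreover have "\<forall>\<^sub>F d in at_right (0::real). 1 = of_real d / (a + of_real d - 1)"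
      using eventually_at_right_less[of 0] by eventually_elim (simp add: True)
    ultimately have "((\<lambda>d. of_real d / (a + of_real d - 1)) \<longlongrightarrow> 1) (at_right (0::real))"
      by (rule Lim_transform_eventually)
    thus ?thesis using True by simp
  next
    case False
    have "((\<lambda>d. of_real d / (a + of_real d - 1)) \<longlongrightarrow> 0 / (a - 1)) (at_right (0::real))"
      using False by (intro tendsto_divide tendsto_diff lim_d lim_a tendsto_const) auto
    thus ?thesis using False by simp
  qed
  hence "((\<lambda>d. of_real d / (a + of_real d - 1) - of_nat m - of_real d * (deriv g (a + of_real d) / g (a + of_real d)))
     \<longlongrightarrow> (if a = 1 then 1 else 0) - of_nat m - 0 * (deriv g a / g a)) (at_right (0::real))"
    using nz[OF ar]
    by (intro tendsto_diff tendsto_mult tendsto_divide lim_d tendsto_const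
          isCont_tendsto_compose[OF cg lim_a] isCont_tendsto_compose[OF cg' lim_a])
  moreover have "\<forall>\<^sub>F d in at_right 0. of_real d / (a + of_real d - 1) - of_nat m
      - of_real d * (deriv g (a + of_real d) / g (a + of_real d)) = of_real d * mangoldt_series (a + of_real d)"
    using eventually_at_right_real[OF r(1)] by eventually_elim (use ident in auto)
  ultimately have "((\<lambda>d. of_real d * mangoldt_series (a + of_real d)) \<longlongrightarrow>
       (if a = 1 then 1 else 0) - of_nat m - 0 * (deriv g a / g a)) (at_right 0)"
    by (rule Lim_transform_eventually)
  thus ?thesis using that[OF m] by simp
qed

lemma Re_mangoldt_series_sums:
  assumes "Re s > 1"
  shows "(\<lambda>n. mangoldt n * real n powr (-Re s) * cos (Im s * ln (real n))) sums Re (mangoldt_series s)"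
proof -
  have "(\<lambda>n. Re (mangoldt n * of_nat n powr (-s))) sums Re (mangoldt_series s)"
    by (rule sums_Re[OF mangoldt_series_sums[OF assms]])
  moreover have "(\<lambda>n. Re (mangoldt n * of_nat n powr (-s))) = (\<lambda>n. mangoldt n * real n powr (-Re s) * cos (Im s * ln (real n)))"
  proof
    show "Re (mangoldt n * of_nat n powr (-s)) = mangoldt n * real n powr (-Re s) * cos (Im s * ln (real n))" for n
      by (cases "n = 0") (auto simp: powr_def Ln_of_nat Re_exp)
  qed
  ultimately show ?thesis by (simp only:)
qed

text \<open>Termwise this is 3 + 4 cos x + cos 2x = 2 (1 + cos x)^2 \<ge> 0 with x = t ln n,
  weighted by the nonnegative mangoldt n * n powr (-\<sigma>).\<close>

lemma mertens_inequality:
  assumes "\<sigma> > 1"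
  shows "0 \<le> 3 * Re (mangoldt_series (of_real \<sigma>)) + 4 * Re (mangoldt_series (Complex \<sigma> t)) + Re (mangoldt_series (Complex \<sigma> (2 * t)))"
proof -
  let ?f = "\<lambda>n. 3 * (mangoldt n * real n powr (-\<sigma>) * cos (0 * ln (real n)))
      + 4 * (mangoldt n * real n powr (-\<sigma>) * cos (t * ln (real n)))
      + mangoldt n * real n powr (-\<sigma>) * cos (2 * t * ln (real n))"
  have S: "?f sums (3 * Re (mangoldt_series (of_real \<sigma>)) + 4 * Re (mangoldt_series (Complex \<sigma> t)) + Re (mangoldt_series (Complex \<sigma> (2 * t))))"
    using assms Re_mangoldt_series_sums[of "of_real \<sigma>"] Re_mangoldt_series_sums[of "Complex \<sigma> t"]
      Re_mangoldt_series_sums[of "Complex \<sigma> (2 * t)"]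
    by (intro sums_add sums_mult) simp_all
  have nonneg: "?f n \<ge> 0" for n
  proof -
    define x where "x = t * ln (real n)"
    have "?f n = mangoldt n * real n powr (-\<sigma>) * (3 + 4 * cos x + cos (2 * x))"
      by (simp add: x_def algebra_simps)
    also have "3 + 4 * cos x + cos (2 * x) = 2 * (1 + cos x)\<^sup>2"
      unfolding cos_double_cos by (simp add: power2_eq_square algebra_simps)
    finally show ?thesis by (simp add: mangoldt_nonneg)
  qed
  show ?thesis by (rule sums_le[OF _ sums_zero S]) (rule nonneg)
qed

text \<open>A zero of multiplicity m \<ge> 1 at 1 + i t would turn the inequality at \<sigma> = 1 +
  d, multiplied by d, into 0 \<le> 3 (1 - k) - 4 m - l in the limit, where k and l are the
  multiplicities at 1 and 1 + 2 i t. The right side is at most 3 - 4. For Re a > 1 the series is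
  bounded near \<open>a\<close>, so the limit - m would be 0.\<close>

theorem reg_zeta_nonzero:
  assumes a: "Re a \<ge> 1"
  shows "reg_zeta a \<noteq> 0"
proof
  assume Za: "reg_zeta a = 0"
  hence a1: "a \<noteq> 1" using reg_zeta_1 by auto
  obtain m where m: "m > 0 \<longleftrightarrow> reg_zeta a = 0"
    "((\<lambda>d. of_real d * mangoldt_series (a + of_real d)) \<longlongrightarrow> (if a = 1 then 1 else 0) - of_nat m) (at_right 0)"
    using mangoldt_series_boundary_limit[OF a] by blast
  have m_pos: "m > 0" using m Za by simp
  have lim: "((\<lambda>d. of_real d * mangoldt_series (a + of_real d)) \<longlongrightarrow> - of_nat m) (at_right 0)"
    using m(2) a1 by simp
  show False
  proof (cases "Re a > 1")
    case True
    define C where "C = (\<Sum>n. ln (real n) * real n powr (-Re a))"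
    have "((\<lambda>d. of_real d * mangoldt_series (a + of_real d)) \<longlongrightarrow> 0) (at_right 0)"
    proof (rule Lim_null_comparison)
      show "\<forall>\<^sub>F d in at_right 0. norm (of_real d * mangoldt_series (a + of_real d)) \<le> d * C"
        using eventually_at_right_less[of 0]
      proof eventually_elim
        case (elim d)
        thus ?case using norm_mangoldt_series_le[OF True, of "a + of_real d"]
          by (auto simp: norm_mult C_def intro!: mult_left_mono)
      qed
      show "((\<lambda>d. d * C) \<longlongrightarrow> 0) (at_right 0)" by (auto intro!: tendsto_eq_intros)
    qed
    from tendsto_unique[OF _ this lim] have "of_nat m = (0::complex)" by simp
    thus False using m_pos by simp
  next
    case False
    define t where "t = Im a"
    have at: "a = Complex 1 t" using False a by (simp add: complex_eq_iff t_def)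
    obtain k where k: "((\<lambda>d. of_real d * mangoldt_series (1 + of_real d)) \<longlongrightarrow> 1 - of_nat k) (at_right 0)"
      using mangoldt_series_boundary_limit[of 1] by auto
    have t0: "t \<noteq> 0" using a1 at by (auto simp: complex_eq_iff)
    have b1: "Complex 1 (2 * t) \<noteq> 1" using t0 by (auto simp: complex_eq_iff)
    obtain l where l: "((\<lambda>d. of_real d * mangoldt_series (Complex 1 (2 * t) + of_real d)) \<longlongrightarrow> - of_nat l) (at_right 0)"
      using mangoldt_series_boundary_limit[of "Complex 1 (2 * t)"] b1 by auto
    have "((\<lambda>d. 3 * Re (of_real d * mangoldt_series (1 + of_real d)) + 4 * Re (of_real d * mangoldt_series (a + of_real d))
            + Re (of_real d * mangoldt_series (Complex 1 (2 * t) + of_real d)))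
          \<longlongrightarrow> 3 * Re (1 - of_nat k) + 4 * Re (- of_nat m) + Re (- of_nat l)) (at_right 0)"
      by (intro tendsto_intros k l lim)
    hence "0 \<le> 3 * Re (1 - of_nat k) + 4 * Re (- of_nat m) + Re (- of_nat l)"
    proof (rule tendsto_lowerbound)
      show "\<forall>\<^sub>F d in at_right 0. 0 \<le> 3 * Re (of_real d * mangoldt_series (1 + of_real d))
            + 4 * Re (of_real d * mangoldt_series (a + of_real d))
            + Re (of_real d * mangoldt_series (Complex 1 (2 * t) + of_real d))"
        using eventually_at_right_less[of 0]
      proof eventually_elim
        case (elim d)
        have e: "1 + of_real d = complex_of_real (1 + d)" "a + of_real d = Complex (1 + d) t"
          "Complex 1 (2 * t) + of_real d = Complex (1 + d) (2 * t)"
          by (simp_all add: complex_eq_iff at)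
        have "0 \<le> d * (3 * Re (mangoldt_series (of_real (1 + d))) + 4 * Re (mangoldt_series (Complex (1 + d) t))
              + Re (mangoldt_series (Complex (1 + d) (2 * t))))"
          using elim by (intro mult_nonneg_nonneg mertens_inequality) auto
        thus ?case unfolding e by (simp add: algebra_simps)
      qed
    qed simp
    thus False using m_pos by simp
  qed
qed

section \<open>The prime number theorem\<close>

text \<open>\<open>powr_integral n w\<close> is the integral of \<open>x powr (- w - 1)\<close> and \<open>psi_integral n z\<close> that of
  \<open>(psi x - x) * x powr (- z - 2)\<close>, both over \<open>[n, n + 1]\<close>.\<close>

definition powr_integral :: "nat \<Rightarrow> complex \<Rightarrow> complex" where
  "powr_integral n w = (if w = 0 then of_real (ln (real (Suc n)) - ln (real n))
            else (of_nat n powr (-w) - of_nat (Suc n) powr (-w)) / w)"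

text \<open>The singularity at w = 0 is removable: the logarithms in the definition are the
  derivative of the numerator there.\<close>

lemma powr_integral_holomorphic:
  assumes n: "n \<ge> 1"
  shows "powr_integral n holomorphic_on UNIV"
proof -
  define f where "f = (\<lambda>w. of_nat n powr (-w) - of_nat (Suc n) powr (-w) :: complex)"
  have f: "f holomorphic_on UNIV" unfolding f_def by (intro holomorphic_intros)
  have f0: "f 0 = 0" using n of_nat_neq_0[of n] by (simp add: f_def del: of_nat_Suc)
  have der: "((\<lambda>w. of_nat k powr (-w) :: complex) has_field_derivative - of_real (ln (real k))) (at 0)" if "k \<ge> 1" for k
  proof -
    have "((\<lambda>w. of_nat k powr (-w)) has_field_derivative (Ln (of_nat k) * of_nat k powr (-0)) * (-1 :: complex)) (at 0)"
      using that by (intro DERIV_chain2[where g = uminus] has_field_derivative_powr_right)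
        (auto intro!: derivative_eq_intros)
    thus ?thesis using that by (simp add: Ln_of_nat)
  qed
  have "(f has_field_derivative (- of_real (ln (real n)) - - of_real (ln (real (Suc n))))) (at 0)"
    unfolding f_def using n by (intro DERIV_diff der) auto
  hence "deriv f 0 = - of_real (ln (real n)) - - of_real (ln (real (Suc n)))" by (rule DERIV_imp_deriv)
  hence "powr_integral n = (\<lambda>w. if w = 0 then deriv f 0 else (f w - f 0) / (w - 0))"
    using f0 by (auto simp: powr_integral_def f_def fun_eq_iff)
  moreover have "(\<lambda>w. if w = 0 then deriv f 0 else (f w - f 0) / (w - 0)) holomorphic_on UNIV"
    using f by (intro pole_lemma) auto
  ultimately show ?thesis by simp
qed

text \<open>Hides the case distinction between a power and a logarithm as primitive. The next
  estimate needs both, since w = z + 1 vanishes at z = -1.\<close>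

lemma powr_integral_primitive:
  obtains P where "powr_integral n w = P (real n + 1) - P (real n)"
    "\<And>x. x > 0 \<Longrightarrow> (P has_vector_derivative of_real x powr (-w - 1)) (at x)"
proof (cases "w = 0")
  case True
  have "((\<lambda>x. complex_of_real (ln x)) has_vector_derivative of_real x powr (-w - 1)) (at x)" if "x > 0" for x
    using that True by (auto intro!: derivative_eq_intros simp: powr_minus divide_inverse
        has_real_derivative_iff_has_vector_derivative[symmetric])
  thus ?thesis using that[of "\<lambda>x. of_real (ln x)"] True by (simp add: powr_integral_def add.commute)
next
  case False
  have "((\<lambda>x. - (of_real x powr (-w)) / w) has_vector_derivative of_real x powr (-w - 1)) (at x)" if "x > 0" for x
  proof -
    have "((\<lambda>x. - (1 / w) * of_real x powr (-w)) has_vector_derivative - (1 / w) * (-w * of_real x powr (-w - 1))) (at x)"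
      by (intro has_vector_derivative_mult_right has_vector_derivative_of_real_powr that)
    thus ?thesis using False by simp
  qed
  thus ?thesis using that[of "\<lambda>x. - (of_real x powr (-w)) / w"] False
    by (simp add: powr_integral_def diff_divide_distrib add.commute)
qed

definition psi_integral :: "nat \<Rightarrow> complex \<Rightarrow> complex" where
  "psi_integral n z = of_real (psi n) * powr_integral n (z + 1) - powr_integral n z"

text \<open>From 0 \<le> psi n \<le> 3 n it follows that |psi n - x| \<le> 3 x on [n, n + 1]. The
  integrand is then at most 3 x powr (-1 - Re z), whose integral is the right side, for either sign
  of Re z.\<close>

lemma norm_psi_integral_le:
  assumes n: "n \<ge> 1" and z: "Re z \<noteq> 0"
  shows "norm (psi_integral n z) \<le> 3 * ((real n powr (-Re z) - real (Suc n) powr (-Re z)) / Re z)"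
proof -
  obtain P where P: "powr_integral n (z + 1) = P (real n + 1) - P (real n)"
    "\<And>x. x > 0 \<Longrightarrow> (P has_vector_derivative of_real x powr (-(z + 1) - 1)) (at x)"
    by (rule powr_integral_primitive) blast
  obtain Q where Q: "powr_integral n z = Q (real n + 1) - Q (real n)"
    "\<And>x. x > 0 \<Longrightarrow> (Q has_vector_derivative of_real x powr (-z - 1)) (at x)"
    by (rule powr_integral_primitive) blast
  define F where "F = (\<lambda>x. of_real (psi n) * P x - Q x)"
  define F' where "F' = (\<lambda>x::real. of_real (psi n) * of_real x powr (-(z + 1) - 1) - of_real x powr (-z - 1) :: complex)"
  define \<phi> where "\<phi> = (\<lambda>x::real. - (3 / Re z) * x powr (-Re z))"
  have F: "(F has_vector_derivative F' x) (at x)" if "x > 0" for x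
    unfolding F_def F'_def using that
    by (intro has_vector_derivative_diff has_vector_derivative_mult_right P Q)
  have e: "-1 - Re z = - Re z - 1" by simp
  have \<phi>: "(\<phi> has_real_derivative 3 * x powr (-1 - Re z)) (at x)" if "x > 0" for x
    unfolding \<phi>_def e using that z by (auto intro!: derivative_eq_intros)
  have "norm (F (real n + 1) - F (real n)) \<le> \<phi> (real n + 1) - \<phi> (real n)"
  proof (rule differentiable_bound_general)
    show "continuous_on {real n..real n + 1} F"
      using n by (intro continuous_at_imp_continuous_on) (auto intro!: has_vector_derivative_continuous[OF F])
    show "continuous_on {real n..real n + 1} \<phi>"
      using n by (intro continuous_at_imp_continuous_on) (auto intro!: DERIV_isCont[OF \<phi>])
    fix x assume x: "real n < x" "x < real n + 1"
    show "(F has_vector_derivative F' x) (at x)" using x by (intro F) auto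
    show "(\<phi> has_vector_derivative 3 * x powr (-1 - Re z)) (at x)"
      using \<phi>[of x] x by (simp add: has_real_derivative_iff_has_vector_derivative)
    have "-z - 1 = 1 + (-(z + 1) - 1)" by simp
    hence "of_real x powr (-z - 1) = (of_real x * of_real x powr (-(z + 1) - 1) :: complex)"
      using x by (simp only: powr_add) simp
    hence "F' x = (of_real (psi n - x)) * of_real x powr (-(z + 1) - 1)"
      unfolding F'_def by (simp add: algebra_simps)
    hence "norm (F' x) = \<bar>psi n - x\<bar> * x powr (-2 - Re z)"
      using x by (simp add: norm_mult norm_powr_real_powr del: of_real_diff)
    also have "\<dots> \<le> (3 * x) * x powr (-2 - Re z)"
      using x psi_le[of n] psi_nonneg[of n] by (intro mult_right_mono) auto
    also have "\<dots> = 3 * (x powr 1 * x powr (-2 - Re z))" using x by simp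
    also have "x powr 1 * x powr (-2 - Re z) = x powr (-1 - Re z)" unfolding powr_add[symmetric] by simp
    finally show "norm (F' x) \<le> 3 * x powr (-1 - Re z)" .
  qed auto
  also have "F (real n + 1) - F (real n) = psi_integral n z"
    unfolding F_def psi_integral_def P(1) Q(1) by (simp add: algebra_simps)
  also have "\<phi> (real n + 1) - \<phi> (real n) = 3 * ((real n powr (-Re z) - real (Suc n) powr (-Re z)) / Re z)"
    using z by (simp add: \<phi>_def field_simps)
  finally show ?thesis .
qed

section \<open>Limit of the integrals for Re z > 0\<close>

text \<open>Summation by parts, \<open>mangoldt\<close> being the increments of \<open>psi\<close>.
  The sum on the right starts at 0 to match \<open>mangoldt_series\<close>; that term is 0.\<close>

lemma psi_sum_by_parts:
  "(\<Sum>n\<in>{1..<Suc N}. of_real (psi n) * (of_nat n powr (-s) - of_nat (Suc n) powr (-s)))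
     = (\<Sum>n<Suc N. mangoldt n * of_nat n powr (-s)) - of_real (psi N) * (of_nat (Suc N) powr (-s) :: complex)"
proof (induction N)
  case (Suc N)
  have "(\<Sum>n\<in>{1..<Suc (Suc N)}. of_real (psi n) * (of_nat n powr (-s) - of_nat (Suc n) powr (-s) :: complex))
     = (\<Sum>n\<in>{1..<Suc N}. of_real (psi n) * (of_nat n powr (-s) - of_nat (Suc n) powr (-s)))
       + of_real (psi (Suc N)) * (of_nat (Suc N) powr (-s) - of_nat (Suc (Suc N)) powr (-s))"
    by (subst sum.atLeastLessThan_Suc) auto
  also note Suc.IH
  also have "(\<Sum>n<Suc N. mangoldt n * of_nat n powr (-s)) = (\<Sum>n<Suc (Suc N). mangoldt n * of_nat n powr (-s))
      - mangoldt (Suc N) * (of_nat (Suc N) powr (-s) :: complex)" by simp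
  finally show ?case unfolding psi_Suc by (simp add: algebra_simps del: of_nat_Suc sum.lessThan_Suc)
qed auto

lemma psi_integral_sums:
  assumes z: "Re z > 0"
  shows "(\<lambda>N. \<Sum>n\<in>{1..<N}. psi_integral n z) \<longlonglongrightarrow> mangoldt_series (z + 1) / (z + 1) - 1 / z"
proof (rule LIMSEQ_imp_Suc)
  define s where "s = z + 1"
  have nz: "z \<noteq> 0" "s \<noteq> 0" using z by (auto simp: s_def complex_eq_iff)
  have tele: "(\<Sum>n\<in>{1..<Suc N}. of_nat n powr (-z) - of_nat (Suc n) powr (-z)) = (1 - of_nat (Suc N) powr (-z) :: complex)" for N
    by (induction N) (auto simp: algebra_simps)
  have part: "(\<Sum>n\<in>{1..<Suc N}. psi_integral n z)
     = ((\<Sum>n<Suc N. mangoldt n * of_nat n powr (-s)) - of_real (psi N) * of_nat (Suc N) powr (-s)) / s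
       - (1 - of_nat (Suc N) powr (-z)) / z" for N
  proof -
    have "psi_integral n z = of_real (psi n) * (of_nat n powr (-s) - of_nat (Suc n) powr (-s)) / s
        - (of_nat n powr (-z) - of_nat (Suc n) powr (-z)) / z" for n
      using nz by (simp add: psi_integral_def powr_integral_def s_def[symmetric] del: of_nat_Suc)
    hence "(\<Sum>n\<in>{1..<Suc N}. psi_integral n z)
        = (\<Sum>n\<in>{1..<Suc N}. of_real (psi n) * (of_nat n powr (-s) - of_nat (Suc n) powr (-s)) / s)
        - (\<Sum>n\<in>{1..<Suc N}. (of_nat n powr (-z) - of_nat (Suc n) powr (-z)) / z)"
      by (simp only: sum_subtractf[of "\<lambda>n. _ n / s" "\<lambda>n. _ n / z"])
    thus ?thesis
      unfolding psi_sum_by_parts[symmetric] tele[symmetric] by (simp only: sum_divide_distrib)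
  qed
  have 1: "(\<lambda>N. \<Sum>n<Suc N. mangoldt n * of_nat n powr (-s)) \<longlonglongrightarrow> mangoldt_series s"
    using mangoldt_series_sums[of s] z by (intro LIMSEQ_Suc) (auto simp: sums_def s_def)
  have 2: "(\<lambda>N. of_nat (Suc N) powr (-z) :: complex) \<longlonglongrightarrow> 0"
    using z by (intro LIMSEQ_Suc tendsto_of_nat_powr_0) auto
  \<comment> \<open>By Chebyshev's bound the boundary term of the summation by parts is O(N powr (-
    Re z)).\<close>
  have 3: "(\<lambda>N. of_real (psi N) * of_nat (Suc N) powr (-s) :: complex) \<longlonglongrightarrow> 0"
  proof (rule Lim_null_comparison)
    show "\<forall>\<^sub>F N in sequentially. norm (of_real (psi N) * of_nat (Suc N) powr (-s) :: complex) \<le> 3 * norm (of_nat (Suc N) powr (-z) :: complex)"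
    proof (intro always_eventually allI)
      fix N
      have "norm (of_real (psi N) * of_nat (Suc N) powr (-s) :: complex) = psi N * real (Suc N) powr (-Re s)"
        by (simp add: norm_mult norm_of_nat_powr psi_nonneg del: of_nat_Suc)
      also have "\<dots> \<le> (3 * real (Suc N)) * real (Suc N) powr (-Re s)"
        using psi_le[of N] by (intro mult_right_mono) auto
      also have "\<dots> = 3 * (real (Suc N) powr 1 * real (Suc N) powr (-Re s))" by simp
      also have "\<dots> = 3 * real (Suc N) powr (-Re z)" unfolding powr_add[symmetric] by (simp add: s_def)
      finally show "norm (of_real (psi N) * of_nat (Suc N) powr (-s) :: complex) \<le> 3 * norm (of_nat (Suc N) powr (-z) :: complex)"
        by (simp add: norm_of_nat_powr del: of_nat_Suc)
    qed
    show "(\<lambda>N. 3 * norm (of_nat (Suc N) powr (-z) :: complex)) \<longlonglongrightarrow> 0"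
      using tendsto_mult_right_zero[OF tendsto_norm_zero[OF 2]] by simp
  qed
  have "(\<lambda>N. \<Sum>n\<in>{1..<Suc N}. psi_integral n z) \<longlonglongrightarrow> (mangoldt_series s - 0) / s - (1 - 0) / z"
    unfolding part using nz by (intro tendsto_intros 1 2 3)
  thus "(\<lambda>N. \<Sum>n\<in>{1..<Suc N}. psi_integral n z) \<longlonglongrightarrow> mangoldt_series (z + 1) / (z + 1) - 1 / z"
    by (simp add: s_def)
qed

theorem psi_asymptotics: "(\<lambda>n. psi n / real n) \<longlonglongrightarrow> 1"
proof (rule psi_asymptotics_from_convergence)
  define U where "U = {z. Re z > -1 \<and> reg_zeta (z + 1) \<noteq> 0}"
  \<comment> \<open>For Re z > 0 the bracket is 1/z + 1 - mangoldt_series (z + 1), and (1/z + 1) /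
    (z + 1) = 1/z. Thus \<open>G\<close> is the limit of the partial sums with the pole at 0 already
    cancelled.\<close>
  define G where "G = (\<lambda>z. - (deriv reg_zeta (z + 1) / reg_zeta (z + 1) + 1) / (z + 1))"
  have "open ((\<lambda>z. z + 1) -` {s. Re s > 0 \<and> reg_zeta s \<noteq> 0})"
    by (intro open_vimage open_reg_zeta_nonzero continuous_intros)
  also have "(\<lambda>z. z + 1) -` {s. Re s > 0 \<and> reg_zeta s \<noteq> 0} = U" by (auto simp: U_def)
  finally have U: "open U" .
  have "(\<lambda>N. \<Sum>n\<in>{1..<N}. psi_integral n 0) \<longlonglongrightarrow> G 0"
  proof (rule newman_tauberian[OF _ _ norm_psi_integral_le U])
    show "psi_integral n holomorphic_on UNIV" if "n \<ge> 1" for n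
    proof -
      have "(powr_integral n \<circ> (\<lambda>z. z + 1)) holomorphic_on UNIV"
        by (rule holomorphic_on_compose_gen[OF _ powr_integral_holomorphic[OF that]]) (auto intro!: holomorphic_intros)
      hence "(\<lambda>z. powr_integral n (z + 1)) holomorphic_on UNIV" by (simp add: o_def)
      thus ?thesis unfolding psi_integral_def
        by (intro holomorphic_intros powr_integral_holomorphic that)
    qed
    show "{z. 0 \<le> Re z} \<subseteq> U" using reg_zeta_nonzero by (auto simp: U_def)
    show "G holomorphic_on U"
    proof -
      have S: "open {s. Re s > 0}" by (rule open_halfspace_Re_gt)
      have "(\<lambda>s. - (deriv reg_zeta s / reg_zeta s + 1) / s) holomorphic_on {s. Re s > 0 \<and> reg_zeta s \<noteq> 0}"
        by (intro holomorphic_intros holomorphic_on_subset[OF reg_zeta_holomorphic]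
              holomorphic_on_subset[OF holomorphic_deriv[OF reg_zeta_holomorphic S]]) auto
      hence "((\<lambda>s. - (deriv reg_zeta s / reg_zeta s + 1) / s) \<circ> (\<lambda>z. z + 1)) holomorphic_on U"
        by (intro holomorphic_on_compose_gen[of _ U]) (auto intro!: holomorphic_intros simp: U_def)
      thus ?thesis by (simp add: G_def o_def)
    qed
    show "(\<lambda>N. \<Sum>n\<in>{1..<N}. psi_integral n z) \<longlonglongrightarrow> G z" if z: "Re z > 0" for z
    proof -
      have "z \<noteq> 0" "z + 1 \<noteq> 0" using z by (auto simp: complex_eq_iff)
      moreover have "reg_zeta (z + 1) \<noteq> 0" using z by (intro reg_zeta_nonzero) auto
      ultimately have "G z = mangoldt_series (z + 1) / (z + 1) - 1 / z"
        using deriv_reg_zeta[of "z + 1"] z by (simp add: G_def) (simp add: field_simps)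
      thus ?thesis using psi_integral_sums[OF z] by simp
    qed
  qed auto
  hence "(\<lambda>N. Re (\<Sum>n\<in>{1..<N}. psi_integral n 0)) \<longlonglongrightarrow> Re (G 0)" by (rule tendsto_Re)
  \<comment> \<open>At z = 0 the \<open>psi\<close> part uses exponent 1 and the other part the
    logarithmic value of \<open>powr_integral\<close>, which reproduces the summand of the
    convergence criterion.\<close>
  moreover have "Re (psi_integral n 0) = psi n / (real n * (real n + 1)) - ln ((real n + 1) / real n)" if "n \<ge> 1" for n
  proof -
    have "(of_nat n powr (-1) - of_nat (Suc n) powr (-1) :: complex) = of_real (1 / real n - 1 / (real n + 1))"
      by (simp add: powr_minus divide_inverse add.commute)
    hence "psi_integral n 0 = of_real (psi n * (1 / real n - 1 / (real n + 1)) - (ln (real (Suc n)) - ln (real n)))"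
      by (simp add: psi_integral_def powr_integral_def)
    hence "Re (psi_integral n 0) = psi n * (1 / real n - 1 / (real n + 1)) - (ln (real (Suc n)) - ln (real n))"
      by (simp only: Re_complex_of_real)
    thus ?thesis using that by (simp add: ln_div field_simps)
  qed
  ultimately have "(\<lambda>N. \<Sum>n\<in>{1..<N}. psi n / (real n * (real n + 1)) - ln ((real n + 1) / real n)) \<longlonglongrightarrow> Re (G 0)"
    by simp
  thus "convergent (\<lambda>N. \<Sum>n\<in>{1..<N}. psi n / (real n * (real n + 1)) - ln ((real n + 1) / real n))"
    by (rule convergentI)
qed

theorem theorem2:
  shows "((\<lambda>x :: real. real (prime_count x) / (x / ln x)) \<longlongrightarrow> 1) at_top"
  by (rule prime_number_theorem_from_psi[OF psi_asymptotics])

end
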